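(* Let $A_0,A_1$ be real $2\times 2$ matrices satisfying conditions (A1)-(A3) of the context, let $\mu$ be the probability measure with $\mu(\{A_0\})=\mu(\{A_1\})=1/2$, and let $\nu$ be the unique $\mu$-stationary measure on $[0,1]$. Consider the conditions (i) $(c_0+d_0-2a_0)(d_0-a_0)=a_0c_0$, (ii) $(a_1-2c_1)(d_1-2b_1)=b_1c_1$. Then: (1) $\nu$ is absolutely continuous (with respect to Lebesgue measure) if and only if both (i) and (ii) hold. (2) $\nu$ is singular (with respect to Lebesgue measure) if and only if either (i) or (ii) fails.
   Context: For a real $2\times2$ matrix $A=\begin{pmatrix} a&b\\c&d\end{pmatrix}$ and $z\in\mathbb{R}$ put $\Phi(A;z)=\frac{az+b}{cz+d}$. The matrices $A_i=\begin{pmatrix} a_i&b_i\\c_i&d_i\end{pmatrix}$, $i=0,1$, satisfy: (A1) $0=b_0<\frac{a_0+b_0}{c_0+d_0}=\frac{b_1}{d_1}<\frac{a_1+b_1}{c_1+d_1}=1$; (A2) $a_id_i-b_ic_i>0$, $i=0,1$; (A3) $(a_id_i-b_ic_i)^{1/2}<\min\{d_i,c_i+d_i\}$, $i=0,1$. Let $G$ be the semigroup of real matrices $\begin{pmatrix} a&b\\c&d\end{pmatrix}$ with $ad>bc$, $b\ge0$, $d>0$, $0<a+b\le c+d$, acting on $M=[0,1]$ by $A\cdot z=\Phi(A;z)$; then $A_0,A_1\in G$. For a probability measure $\mu$ on $G$, a Borel probability measure $\nu$ on $[0,1]$ is called $\mu$-stationary if $\nu(B)=\int_G\nu(h^{-1}B)\,\mu(dh)$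 for every Borel set $B\subset[0,1]$, where $h^{-1}B=\{z\in[0,1]: h\cdot z\in B\}$. For $\mu$ with $\mu(\{A_0\})=\mu(\{A_1\})=1/2$ this reads $\nu(B)=\frac12\nu(A_0^{-1}B)+\frac12\nu(A_1^{-1}B)$, and there is exactly one $\mu$-stationary measure. *)

theory Defs
  imports "HOL-Probability.Probability"
begin

definition mat22 :: "real \<Rightarrow> real \<Rightarrow> real \<Rightarrow> real \<Rightarrow> real^2^2" where
  "mat22 a b c d = vector [vector [a, b], vector [c, d]]"

definition Phi :: "real^2^2 \<Rightarrow> real \<Rightarrow> real" where
  "Phi A z = moebius (A$1$1) (A$1$2) (A$2$1) (A$2$2) z"

text \<open>
  On \<open>G\<close> one has \<open>d > 0\<close> and \<open>c + d > 0\<close>, so the denominator of \<open>Phi A z\<close> does not vanish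
  for \<open>z \<in> {0..1}\<close>, and \<open>Phi A\<close> maps \<open>{0..1}\<close> into itself.
\<close>

definition G :: "(real^2^2) set" where
  "G = {mat22 a b c d | a b c d.
          a * d > b * c \<and> b \<ge> 0 \<and> d > 0 \<and> 0 < a + b \<and> a + b \<le> c + d}"

definition prob_measure_on :: "'a::topological_space set \<Rightarrow> 'a measure \<Rightarrow> bool" where
  "prob_measure_on S M \<longleftrightarrow> prob_space M \<and> sets M = sets (restrict_space borel S)"

definition stationary :: "(real^2^2) measure \<Rightarrow> real measure \<Rightarrow> bool" where
  "stationary \<mu> \<nu> \<longleftrightarrow> prob_measure_on {0..1} \<nu> \<and>
     (\<forall>B \<in> sets \<nu>. emeasure \<nu> B = (\<integral>\<^sup>+ h. emeasure \<nu> {z \<in> {0..1}. Phi h z \<in> B} \<partial>\<mu>))"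

abbreviation lebesgue01 :: "real measure" where
  "lebesgue01 \<equiv> restrict_space lborel {0..1}"

text \<open>Meaningful for measures with the same \<open>\<sigma>\<close>-algebra, like \<^const>\<open>absolutely_continuous\<close>;
  the arguments are ordered as there, with the reference measure first.\<close>

definition mutually_singular :: "'a measure \<Rightarrow> 'a measure \<Rightarrow> bool" where
  "mutually_singular M N \<longleftrightarrow>
     (\<exists>S \<in> sets M. emeasure M S = 0 \<and> emeasure N (space N - S) = 0)"

end

theory Submission
  imports Defs
begin

text \<open>
  Write \<open>f0\<close>, \<open>f1\<close> for the actions of \<open>A0\<close>, \<open>A1\<close> and \<open>F\<close> for the distribution function of \<open>\<nu>\<close>, so
  that \<open>F \<circ> f0 = F/2\<close> and \<open>F \<circ> f1 = (1 + F)/2\<close> on \<open>[0,1]\<close>. Given (A1)-(A3), conditions (i) and (ii)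
  factor as \<open>d0 = 2 a0\<close> and \<open>d1 = 2 b1 + c1\<close>, that is \<open>f0' 0 = f1' 1 = 1/2\<close>. They hold exactly when
  the Moebius map \<open>M\<close> with \<open>M 0 = 0\<close>, \<open>M (f0 1) = 1/2\<close>, \<open>M 1 = 1\<close> solves these equations; since
  bounded solutions are unique, \<open>F = M\<close> then has a density.

  Conversely, if \<open>\<nu>\<close> is not singular, its absolutely continuous part is again stationary up to a
  factor, with density \<open>h\<close>, say. On suitable small cylinders \<open>f\<^bsub>w\<^esub> [0,1]\<close> the density \<open>h\<close> is almost
  constant in the mean, so the distribution function of the part in the cylinder is almost affine.
  Pulled back by \<open>f\<^bsub>w\<^esub>\<close>, this says that \<open>F\<close> is uniformly close to a Moebius map fixing \<open>0\<close> and \<open>1\<close>.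
  By compactness \<open>F\<close> is itself such a map, and this forces (i) and (ii).
\<close>

section \<open>Moebius maps on the unit interval\<close>

text \<open>The denominator is affine in \<open>x\<close>, hence a convex combination of its values
  \<open>d\<close> at 0 and \<open>c + d\<close> at 1.\<close>

lemma moebius_denom_pos:
  fixes c d x :: real
  assumes "0 < d" "0 < c + d" "0 \<le> x" "x \<le> 1"
  shows "min d (c + d) \<le> c * x + d" "0 < c * x + d"
proof -
  have "c * x + d = (1 - x) * d + x * (c + d)"
    by (simp add: algebra_simps)
  moreover have "(1 - x) * min d (c + d) + x * min d (c + d) \<le> (1 - x) * d + x * (c + d)"
    using assms by (intro add_mono mult_left_mono) auto
  ultimately show *: "min d (c + d) \<le> c * x + d"
    by (simp add: algebra_simps)
  show "0 < c * x + d"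
    using * assms by linarith
qed

text \<open>This exact formula yields both monotonicity and the Lipschitz bound, without
  derivatives.\<close>

lemma moebius_diff:
  fixes a b c d x y :: real
  assumes "c * x + d \<noteq> 0" "c * y + d \<noteq> 0"
  shows "moebius a b c d x - moebius a b c d y =
    (a * d - b * c) * (x - y) / ((c * x + d) * (c * y + d))"
  using assms unfolding moebius_def by (simp add: divide_simps) (simp add: algebra_simps)

text \<open>No pole in [0,1] and orientation preserving. The image may leave [0,1]; where that
  matters, it is controlled separately.\<close>

definition pos_moebius :: "real \<Rightarrow> real \<Rightarrow> real \<Rightarrow> real \<Rightarrow> bool" where
  "pos_moebius a b c d \<longleftrightarrow> 0 < d \<and> 0 < c + d \<and> b * c < a * d"

lemma pos_moebius_strict_mono:
  assumes "pos_moebius a b c d" "0 \<le> x" "x < y" "y \<le> 1"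
  shows "moebius a b c d x < moebius a b c d y"
proof -
  have pos: "0 < c * x + d" "0 < c * y + d"
    using assms moebius_denom_pos[of d c] by (auto simp: pos_moebius_def)
  have "0 < (a * d - b * c) * (y - x) / ((c * y + d) * (c * x + d))"
    using assms pos by (auto simp: pos_moebius_def)
  then show ?thesis
    using moebius_diff[of c y d x a b] pos by linarith
qed

lemma pos_moebius_mono:
  assumes "pos_moebius a b c d" "0 \<le> x" "x \<le> y" "y \<le> 1"
  shows "moebius a b c d x \<le> moebius a b c d y"
  using pos_moebius_strict_mono[of a b c d x y] assms by (cases "x = y") auto

lemma pos_moebius_le_iff:
  assumes "pos_moebius a b c d" "x \<in> {0..1}" "y \<in> {0..1}"
  shows "moebius a b c d x \<le> moebius a b c d y \<longleftrightarrow> x \<le> y"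
  using pos_moebius_strict_mono[of a b c d y x] pos_moebius_mono[of a b c d x y] assms
  by (auto simp: not_le[symmetric])

lemma pos_moebius_lipschitz:
  assumes "pos_moebius a b c d" "x \<in> {0..1}" "y \<in> {0..1}"
  shows "\<bar>moebius a b c d x - moebius a b c d y\<bar> \<le>
    (a * d - b * c) / (min d (c + d))\<^sup>2 * \<bar>x - y\<bar>"
proof -
  define m where "m = min d (c + d)"
  have m: "0 < m" and D: "0 < a * d - b * c"
    using assms by (auto simp: m_def pos_moebius_def)
  have mx: "m \<le> c * x + d" and my: "m \<le> c * y + d"
    using assms moebius_denom_pos[of d c] by (auto simp: pos_moebius_def m_def)
  have "\<bar>moebius a b c d x - moebius a b c d y\<bar> =
      (a * d - b * c) * \<bar>x - y\<bar> / ((c * x + d) * (c * y + d))"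
    using m mx my D by (subst moebius_diff) (auto simp: abs_mult)
  also have "\<dots> \<le> (a * d - b * c) * \<bar>x - y\<bar> / (m * m)"
    using m mx my D by (intro divide_left_mono mult_mono mult_pos_pos) auto
  finally show ?thesis
    by (simp add: m_def power2_eq_square)
qed

text \<open>The coefficients are those of the matrix product, so the determinant is multiplicative.
  At 0 and 1 the new denominator is the inner denominator times the outer one, taken at the inner
  image point \<open>b' / d'\<close> or \<open>(a' + b') / (c' + d')\<close>, which lies in
  [0,1].\<close>

lemma pos_moebius_comp:
  assumes K: "pos_moebius a b c d"
    and F: "pos_moebius a' b' c' d'" "0 \<le> b'" "b' \<le> d'" "0 \<le> a' + b'" "a' + b' \<le> c' + d'"
  shows "pos_moebius (a * a' + b * c') (a * b' + b * d') (c * a' + d * c') (c * b' + d * d')"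
    and "0 \<le> x \<Longrightarrow> x \<le> 1 \<Longrightarrow>
      moebius (a * a' + b * c') (a * b' + b * d') (c * a' + d * c') (c * b' + d * d') x =
      moebius a b c d (moebius a' b' c' d' x)"
proof -
  have cd: "0 < d" "0 < c + d" and cd': "0 < d'" "0 < c' + d'"
    and D: "0 < a * d - b * c" "0 < a' * d' - b' * c'"
    using K F by (auto simp: pos_moebius_def)
  have "0 < c * (b' / d') + d"
    using moebius_denom_pos(2)[of d c "b' / d'"] cd cd' F by auto
  then have "0 < d' * (c * (b' / d') + d)"
    using cd' by (intro mult_pos_pos)
  then have 1: "0 < c * b' + d * d'"
    using cd' by (simp add: algebra_simps)
  have "0 < c * ((a' + b') / (c' + d')) + d"
    using moebius_denom_pos(2)[of d c "(a' + b') / (c' + d')"] cd cd' F by auto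
  then have "0 < (c' + d') * (c * ((a' + b') / (c' + d')) + d)"
    using cd' by (intro mult_pos_pos)
  also have "\<dots> = c * (a' + b') + d * (c' + d')"
    using cd' by (simp add: field_simps)
  finally have 2: "0 < (c * a' + d * c') + (c * b' + d * d')"
    by (simp add: algebra_simps)
  have 3: "0 < (a * d - b * c) * (a' * d' - b' * c')"
    using D by (rule mult_pos_pos)
  show "pos_moebius (a * a' + b * c') (a * b' + b * d') (c * a' + d * c') (c * b' + d * d')"
    using 1 2 3 unfolding pos_moebius_def by (auto simp: algebra_simps)
  show "moebius (a * a' + b * c') (a * b' + b * d') (c * a' + d * c') (c * b' + d * d') x =
      moebius a b c d (moebius a' b' c' d' x)" if "0 \<le> x" "x \<le> 1"
  proof -
    have 4: "0 < c' * x + d'"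
      using that cd' by (intro moebius_denom_pos)
    show ?thesis
    proof -
      have A: "a * ((a' * x + b') / (c' * x + d')) + b =
          ((a * a' + b * c') * x + (a * b' + b * d')) / (c' * x + d')"
        using 4 by (simp add: field_simps)
      have B: "c * ((a' * x + b') / (c' * x + d')) + d =
          ((c * a' + d * c') * x + (c * b' + d * d')) / (c' * x + d')"
        using 4 by (simp add: field_simps)
      show ?thesis
        unfolding moebius_def A B using 4 by simp
    qed
  qed
qed

text \<open>The Moebius bijection of \<open>[0,1]\<close> fixing both end points and sending \<open>s\<close> to \<open>1/2\<close>.\<close>

definition normal_moebius :: "real \<Rightarrow> real \<Rightarrow> real" where
  "normal_moebius s v = (1 - s) * v / (s + (1 - 2 * s) * v)"

lemma normal_moebius_denom_pos:
  fixes s v :: real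
  assumes "0 < s" "s < 1" "v \<in> {0..1}"
  shows "0 < s + (1 - 2 * s) * v"
  using moebius_denom_pos(2)[of s "1 - 2 * s" v] assms by (simp add: add.commute)

text \<open>An affine rescaling of the image leaves \<open>(c + d) * x / (c * x + d)\<close>, a
  family with a single parameter. Solving for the point with value 1/2 gives
  \<open>s = d / (c + 2 * d)\<close>.\<close>

lemma pos_moebius_normalise:
  assumes "pos_moebius a b c d" and k: "\<And>x. x \<in> {0..1} \<Longrightarrow> k x = moebius a b c d x"
  obtains s where "0 < s" "s < 1" "k 0 < k 1"
    "\<And>x. x \<in> {0..1} \<Longrightarrow> (k x - k 0) / (k 1 - k 0) = normal_moebius s x"
proof
  have cd: "0 < d" "0 < c + d" "0 < a * d - b * c"
    using assms(1) by (auto simp: pos_moebius_def)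
  have e: "0 < c + 2 * d"
    using cd by linarith
  show "0 < d / (c + 2 * d)" "d / (c + 2 * d) < 1"
    using cd e by auto
  have diff: "k x - k 0 = (a * d - b * c) * x / ((c * x + d) * d)"
    and den: "0 < c * x + d" if "x \<in> {0..1}" for x
    using that moebius_denom_pos(2)[of d c x] cd moebius_diff[of c x d 0 a b] by (auto simp: k)
  show "k 0 < k 1"
    using diff[of 1] cd by (smt (verit) atLeastAtMost_iff divide_pos_pos mult_pos_pos mult.right_neutral)
  show "(k x - k 0) / (k 1 - k 0) = normal_moebius (d / (c + 2 * d)) x" if x: "x \<in> {0..1}" for x
  proof -
    have "D * x / (s * d) / (D * 1 / (t * d)) = t * x / s"
      if "D \<noteq> 0" "s \<noteq> 0" "t \<noteq> 0" for D s t :: real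
      using that cd by (simp add: field_simps)
    then have "(k x - k 0) / (k 1 - k 0) = (c + d) * x / (c * x + d)"
      using cd den[OF x] diff[OF x] diff[of 1] by simp
    also have "\<dots> = ((c + d) / (c + 2 * d) * x) / ((c * x + d) / (c + 2 * d))"
      using e by simp
    also have "(c + d) / (c + 2 * d) = 1 - d / (c + 2 * d)"
      using e by (simp add: field_simps)
    also have "(c * x + d) / (c + 2 * d) =
        d / (c + 2 * d) + (1 - 2 * (d / (c + 2 * d))) * x"
      using e by (simp add: divide_simps)
    finally show ?thesis
      by (simp add: normal_moebius_def)
  qed
qed

section \<open>Approximation of integrable functions\<close>

text \<open>Dominated convergence is used twice: for truncations of \<open>h\<close> at height
  \<open>k\<close>, and for continuous functions converging almost everywhere to such a
  truncation.\<close>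

lemma integrable_approx_continuous:
  fixes h :: "real \<Rightarrow> real"
  assumes h: "h absolutely_integrable_on {a..b}" and nonneg: "\<And>x. 0 \<le> h x" and e: "0 < e"
  obtains g where "continuous_on {a..b} g" "integral {a..b} (\<lambda>x. \<bar>h x - g x\<bar>) < e"
proof -
  have h_int: "h integrable_on {a..b}"
    using h by (rule set_lebesgue_integral_eq_integral)
  have trunc_int: "(\<lambda>x. min (h x) (real k)) absolutely_integrable_on {a..b}" for k
    by (intro absolutely_integrable_min_1 h) simp
  have "(\<lambda>k. integral {a..b} (\<lambda>x. min (h x) (real k))) \<longlonglongrightarrow> integral {a..b} h"
  proof (rule dominated_convergence(2)[where h = h])
    show "(\<lambda>x. min (h x) (real k)) integrable_on {a..b}" for k
      using trunc_int by (rule set_lebesgue_integral_eq_integral)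
    show "norm (min (h x) (real k)) \<le> h x" for k x
      using nonneg[of x] by auto
    show "(\<lambda>k. min (h x) (real k)) \<longlonglongrightarrow> h x" for x
    proof (rule tendsto_eventually)
      show "\<forall>\<^sub>F k in sequentially. min (h x) (real k) = h x"
        using eventually_ge_at_top[of "nat \<lceil>h x\<rceil>"] by eventually_elim linarith
    qed
  qed (use h_int in auto)
  then have "\<forall>\<^sub>F k in sequentially. dist (integral {a..b} (\<lambda>x. min (h x) (real k))) (integral {a..b} h) < e / 2"
    using e by (intro tendstoD) auto
  then obtain k :: nat where k: "dist (integral {a..b} (\<lambda>x. min (h x) (real k))) (integral {a..b} h) < e / 2"
    by (auto simp: eventually_sequentially)
  define u where "u = (\<lambda>x. min (h x) (real k))"
  have u: "u absolutely_integrable_on {a..b}"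
    using trunc_int unfolding u_def .
  have "u \<in> borel_measurable (lebesgue_on {a..b})"
    using absolutely_integrable_measurable[of "{a..b}" u] u by simp
  then have "u measurable_on {a..b}"
    using lebesgue_measurable_imp_measurable_on[OF borel_measurable_if_I, of u "{a..b}" UNIV]
      measurable_on_UNIV[of "{a..b}" u] by simp
  then obtain N w where N: "negligible N" and w: "\<And>n. continuous_on UNIV (w n)"
    and lim: "\<And>x. x \<notin> N \<Longrightarrow> (\<lambda>n. w n x) \<longlonglongrightarrow> (if x \<in> {a..b} then u x else 0)"
    unfolding measurable_on_def by metis
  \<comment> \<open>Clipping to [0,k] keeps continuity and the limit, and makes the constant
    \<open>k\<close> a dominating function.\<close>
  define v where "v = (\<lambda>n x. max 0 (min (w n x) (real k)))"
  have v: "continuous_on {a..b} (v n)" for n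
    unfolding v_def by (intro continuous_intros continuous_on_subset[OF w]) auto
  have v_int: "v n absolutely_integrable_on {a..b}" for n
    by (rule absolutely_integrable_continuous_real[OF v])
  have "(\<lambda>n. integral ({a..b} - N) (\<lambda>x. \<bar>u x - v n x\<bar>)) \<longlonglongrightarrow> integral ({a..b} - N) (\<lambda>x. 0)"
  proof (rule dominated_convergence(2)[where h = "\<lambda>x. real k"])
    have "(\<lambda>x. \<bar>u x - v n x\<bar>) integrable_on {a..b}" for n
      by (intro set_lebesgue_integral_eq_integral set_integrable_abs set_integral_diff u v_int)
    then show "(\<lambda>x. \<bar>u x - v n x\<bar>) integrable_on ({a..b} - N)" for n
      by (rule integrable_spike_set) (auto intro: negligible_subset[OF N])
    have "(\<lambda>x. real k) integrable_on {a..b}"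
      by (intro integrable_continuous_real continuous_intros)
    then show "(\<lambda>x. real k) integrable_on ({a..b} - N)"
      by (rule integrable_spike_set) (auto intro: negligible_subset[OF N])
    show "norm \<bar>u x - v n x\<bar> \<le> real k" for n x
      using nonneg[of x] unfolding u_def v_def by (auto simp: min_def max_def)
    show "(\<lambda>n. \<bar>u x - v n x\<bar>) \<longlonglongrightarrow> 0" if "x \<in> {a..b} - N" for x
    proof -
      have "(\<lambda>n. w n x) \<longlonglongrightarrow> u x"
        using lim[of x] that by simp
      then have "(\<lambda>n. \<bar>u x - v n x\<bar>) \<longlonglongrightarrow> \<bar>u x - max 0 (min (u x) (real k))\<bar>"
        unfolding v_def by (intro tendsto_intros)
      then show ?thesis
        using nonneg[of x] by (simp add: u_def)
    qed
  qed
  moreover have "integral ({a..b} - N) f = integral {a..b} f" for f :: "real \<Rightarrow> real"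
    by (rule integral_spike_set) (auto intro: negligible_subset[OF N])
  ultimately have "(\<lambda>n. integral {a..b} (\<lambda>x. \<bar>u x - v n x\<bar>)) \<longlonglongrightarrow> 0"
    by simp
  then have "\<forall>\<^sub>F n in sequentially. dist (integral {a..b} (\<lambda>x. \<bar>u x - v n x\<bar>)) 0 < e / 2"
    using e by (intro tendstoD) auto
  then obtain n where n: "dist (integral {a..b} (\<lambda>x. \<bar>u x - v n x\<bar>)) 0 < e / 2"
    by (auto simp: eventually_sequentially)
  have uh_int: "(\<lambda>x. h x - u x) integrable_on {a..b}"
    by (intro set_lebesgue_integral_eq_integral set_integral_diff h u)
  have uv_int: "(\<lambda>x. \<bar>u x - v n x\<bar>) integrable_on {a..b}"
    by (intro set_lebesgue_integral_eq_integral set_integrable_abs set_integral_diff u v_int)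
  have "integral {a..b} (\<lambda>x. \<bar>h x - v n x\<bar>) \<le>
      integral {a..b} (\<lambda>x. (h x - u x) + \<bar>u x - v n x\<bar>)"
  proof (rule integral_le)
    show "(\<lambda>x. \<bar>h x - v n x\<bar>) integrable_on {a..b}"
      by (intro set_lebesgue_integral_eq_integral set_integrable_abs set_integral_diff h v_int)
    show "(\<lambda>x. (h x - u x) + \<bar>u x - v n x\<bar>) integrable_on {a..b}"
      by (intro integrable_add uh_int uv_int)
    show "\<bar>h x - v n x\<bar> \<le> (h x - u x) + \<bar>u x - v n x\<bar>" for x
      unfolding u_def by linarith
  qed
  also have "\<dots> = integral {a..b} h - integral {a..b} u + integral {a..b} (\<lambda>x. \<bar>u x - v n x\<bar>)"
    using u by (simp add: Henstock_Kurzweil_Integration.integral_add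
        Henstock_Kurzweil_Integration.integral_diff uh_int uv_int h_int
        set_lebesgue_integral_eq_integral)
  also have "\<dots> < e"
    using k n unfolding u_def dist_real_def by linarith
  finally show ?thesis
    using that v by blast
qed

section \<open>Self-similar distribution functions\<close>

text \<open>Conditions (A1)-(A3) with \<open>b0 = 0\<close> substituted and the square roots
  removed. \<open>glue\<close> and \<open>end1\<close> make the images of [0,1] adjacent intervals
  that fill [0,1].\<close>

locale moebius_ifs =
  fixes a0 c0 d0 a1 b1 c1 d1 :: real
  assumes pos0: "0 < a0" "0 < d0" "a0 < c0 + d0"
    and pos1: "0 < d1" "0 < c1 + d1" "b1 * c1 < a1 * d1"
    and contr0: "a0 * d0 < d0\<^sup>2" "a0 * d0 < (c0 + d0)\<^sup>2"
    and contr1: "a1 * d1 - b1 * c1 < d1\<^sup>2" "a1 * d1 - b1 * c1 < (c1 + d1)\<^sup>2"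
    and glue: "a0 / (c0 + d0) = b1 / d1"
    and end1: "a1 + b1 = c1 + d1"
begin

definition f0 :: "real \<Rightarrow> real" where "f0 = moebius a0 0 c0 d0"
definition f1 :: "real \<Rightarrow> real" where "f1 = moebius a1 b1 c1 d1"
text \<open>The common end point of the two image intervals [0,p] and [p,1].\<close>

definition p :: real where "p = a0 / (c0 + d0)"

lemma pos_f0: "pos_moebius a0 0 c0 d0"
  using pos0 by (auto simp: pos_moebius_def)

lemma pos_f1: "pos_moebius a1 b1 c1 d1"
  using pos1 by (auto simp: pos_moebius_def)

lemma p_bounds: "0 < p" "p < 1"
  using pos0 by (auto simp: p_def)

lemma p_eq: "a0 = p * (c0 + d0)" "b1 = p * d1" "a1 = c1 + d1 - p * d1"
proof -
  show "a0 = p * (c0 + d0)"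
    using pos0 by (simp add: p_def)
  show b1: "b1 = p * d1"
    using pos1 glue by (simp add: p_def)
  show "a1 = c1 + d1 - p * d1"
    using end1 b1 by linarith
qed

lemma f_ends: "f0 0 = 0" "f0 1 = p" "f1 0 = p" "f1 1 = 1"
  using pos0 pos1 glue end1 by (auto simp: f0_def f1_def p_def moebius_def)

lemma f0_mono: "0 \<le> x \<Longrightarrow> x \<le> y \<Longrightarrow> y \<le> 1 \<Longrightarrow> f0 x \<le> f0 y"
  unfolding f0_def by (rule pos_moebius_mono[OF pos_f0])

lemma f1_mono: "0 \<le> x \<Longrightarrow> x \<le> y \<Longrightarrow> y \<le> 1 \<Longrightarrow> f1 x \<le> f1 y"
  unfolding f1_def by (rule pos_moebius_mono[OF pos_f1])

lemma f0_mem: "x \<in> {0..1} \<Longrightarrow> f0 x \<in> {0..p}"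
  using f0_mono[of 0 x] f0_mono[of x 1] by (auto simp: f_ends)

lemma f1_mem: "x \<in> {0..1} \<Longrightarrow> f1 x \<in> {p..1}"
  using f1_mono[of 0 x] f1_mono[of x 1] by (auto simp: f_ends)

lemma f_mem01: "x \<in> {0..1} \<Longrightarrow> f0 x \<in> {0..1}" "x \<in> {0..1} \<Longrightarrow> f1 x \<in> {0..1}"
  using f0_mem[of x] f1_mem[of x] p_bounds by auto

text \<open>A common bound for both derivatives on [0,1], each being the determinant over the
  squared denominator.\<close>

definition rate :: real where
  "rate = max (a0 * d0 / (min d0 (c0 + d0))\<^sup>2) ((a1 * d1 - b1 * c1) / (min d1 (c1 + d1))\<^sup>2)"

lemma rate_bounds: "0 \<le> rate" "rate < 1"
proof -
  show "rate < 1"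
    using pos0 pos1 contr0 contr1 by (auto simp: rate_def min_def divide_simps)
  have "0 \<le> a0 * d0 / (min d0 (c0 + d0))\<^sup>2"
    using pos0 by simp
  then show "0 \<le> rate"
    by (simp add: rate_def)
qed

lemma f_contraction:
  assumes "x \<in> {0..1}" "y \<in> {0..1}"
  shows "\<bar>f0 x - f0 y\<bar> \<le> rate * \<bar>x - y\<bar>" "\<bar>f1 x - f1 y\<bar> \<le> rate * \<bar>x - y\<bar>"
proof -
  have "\<bar>f0 x - f0 y\<bar> \<le> a0 * d0 / (min d0 (c0 + d0))\<^sup>2 * \<bar>x - y\<bar>"
    using pos_moebius_lipschitz[OF pos_f0 assms] by (simp add: f0_def)
  also have "\<dots> \<le> rate * \<bar>x - y\<bar>"
    by (intro mult_right_mono) (auto simp: rate_def)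
  finally show "\<bar>f0 x - f0 y\<bar> \<le> rate * \<bar>x - y\<bar>" .
  have "\<bar>f1 x - f1 y\<bar> \<le> (a1 * d1 - b1 * c1) / (min d1 (c1 + d1))\<^sup>2 * \<bar>x - y\<bar>"
    using pos_moebius_lipschitz[OF pos_f1 assms] by (simp add: f1_def)
  also have "\<dots> \<le> rate * \<bar>x - y\<bar>"
    by (intro mult_right_mono) (auto simp: rate_def)
  finally show "\<bar>f1 x - f1 y\<bar> \<le> rate * \<bar>x - y\<bar>" .
qed

definition self_similar :: "(real \<Rightarrow> real) \<Rightarrow> bool" where
  "self_similar F \<longleftrightarrow> F 0 = 0 \<and> F 1 = 1 \<and>
    (\<forall>x\<in>{0..1}. F (f0 x) = F x / 2 \<and> F (f1 x) = (1 + F x) / 2)"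

lemma self_similarD:
  assumes "self_similar F"
  shows "F 0 = 0" "F 1 = 1"
    "x \<in> {0..1} \<Longrightarrow> F (f0 x) = F x / 2" "x \<in> {0..1} \<Longrightarrow> F (f1 x) = (1 + F x) / 2"
  using assms by (auto simp: self_similar_def)

lemma f_surj:
  assumes "y \<in> {0..1}"
  obtains x where "x \<in> {0..1}" "y = f0 x" | x where "x \<in> {0..1}" "y = f1 x"
proof -
  have cont: "continuous_on {0..1} (moebius a b c d)" if "pos_moebius a b c d" for a b c d
    unfolding moebius_def using that moebius_denom_pos(2)[of d c]
    by (intro continuous_intros) (force simp: pos_moebius_def)
  show ?thesis
  proof (cases "y \<le> p")
    case True
    then obtain x where "0 \<le> x" "x \<le> 1" "f0 x = y"
      using IVT'[of f0 0 y 1] cont[OF pos_f0] assms f_ends by (auto simp: f0_def)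
    then show ?thesis
      using that(1)[of x] by auto
  next
    case False
    then obtain x where "0 \<le> x" "x \<le> 1" "f1 x = y"
      using IVT'[of f1 0 y 1] cont[OF pos_f1] assms f_ends by (auto simp: f1_def)
    then show ?thesis
      using that(2)[of x] by auto
  qed
qed

text \<open>The distance of two solutions is at most 1, and each use of the equations halves the
  bound.\<close>

lemma self_similar_unique:
  assumes F: "self_similar F" "\<And>x. x \<in> {0..1} \<Longrightarrow> F x \<in> {0..1}"
    and H: "self_similar H" "\<And>x. x \<in> {0..1} \<Longrightarrow> H x \<in> {0..1}"
    and x: "x \<in> {0..1}"
  shows "F x = H x"
proof -
  have "\<bar>F x - H x\<bar> \<le> (1 / 2) ^ n" if "x \<in> {0..1}" for n x
    using that
  proof (induction n arbitrary: x)
    case 0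
    then show ?case
      using F(2)[of x] H(2)[of x] by auto
  next
    case (Suc n)
    have Fs: "F (f0 z) = F z / 2" "F (f1 z) = (1 + F z) / 2"
      and Hs: "H (f0 z) = H z / 2" "H (f1 z) = (1 + H z) / 2" if "z \<in> {0..1}" for z
      using self_similarD[OF F(1)] self_similarD[OF H(1)] that by auto
    have half: "\<bar>s / 2 - t / 2\<bar> = \<bar>s - t\<bar> / 2"
        "\<bar>(1 + s) / 2 - (1 + t) / 2\<bar> = \<bar>s - t\<bar> / 2" for s t :: real
      by (auto simp: abs_if field_simps)
    \<comment> \<open>The point \<open>z\<close> is a preimage of \<open>x\<close> under
      \<open>f0\<close> or \<open>f1\<close>, one of which exists as the images cover [0,1].\<close>
    have "\<exists>z\<in>{0..1}. \<bar>F x - H x\<bar> = \<bar>F z - H z\<bar> / 2"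
    proof (rule f_surj[OF Suc.prems])
      fix z assume z: "z \<in> {0..1}" "x = f0 z"
      then show ?thesis
        unfolding z(2) by (intro bexI[OF _ z(1)]) (simp only: Fs(1) Hs(1) half(1))
    next
      fix z assume z: "z \<in> {0..1}" "x = f1 z"
      then show ?thesis
        unfolding z(2) by (intro bexI[OF _ z(1)]) (simp only: Fs(2) Hs(2) half(2))
    qed
    then show ?case
      using Suc.IH by fastforce
  qed
  then have "\<bar>F x - H x\<bar> \<le> 0"
    using x by (intro LIMSEQ_le_const[OF LIMSEQ_realpow_zero[of "1 / 2 :: real"]]) auto
  then show ?thesis
    by simp
qed

section \<open>Cylinder maps\<close>

text \<open>Compositions of \<open>n\<close> maps. The new map is added on the inside, so that
  lengthening the word subdivides the interval \<open>k\<close> [0,1] at \<open>k p\<close>.\<close>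

inductive cylinder :: "nat \<Rightarrow> (real \<Rightarrow> real) \<Rightarrow> bool" where
  base: "cylinder 0 (\<lambda>x. x)"
| left: "cylinder n k \<Longrightarrow> cylinder (Suc n) (\<lambda>x. k (f0 x))"
| right: "cylinder n k \<Longrightarrow> cylinder (Suc n) (\<lambda>x. k (f1 x))"

lemma cylinder_moebius:
  assumes "cylinder n k"
  obtains a b c d where "pos_moebius a b c d" "\<And>x. x \<in> {0..1} \<Longrightarrow> k x = moebius a b c d x"
proof -
  from assms have "\<exists>a b c d. pos_moebius a b c d \<and> (\<forall>x\<in>{0..1}. k x = moebius a b c d x)"
  proof induction
    case base
    show ?case
      by (intro exI[of _ 1] exI[of _ 0]) (auto simp: pos_moebius_def moebius_def)
  next
    case (left n k)
    then obtain a b c d where K: "pos_moebius a b c d" "\<And>x. x \<in> {0..1} \<Longrightarrow> k x = moebius a b c d x"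
      by blast
    have side: "0 \<le> d0" "0 \<le> a0 + 0" "a0 + 0 \<le> c0 + d0"
      using pos0 by auto
    show ?case
      using pos_moebius_comp[OF K(1) pos_f0 order_refl side] K(2) f_mem01 unfolding f0_def
      by (metis atLeastAtMost_iff)
  next
    case (right n k)
    then obtain a b c d where K: "pos_moebius a b c d" "\<And>x. x \<in> {0..1} \<Longrightarrow> k x = moebius a b c d x"
      by blast
    have side: "0 \<le> b1" "b1 \<le> d1" "0 \<le> a1 + b1" "a1 + b1 \<le> c1 + d1"
      using pos1 p_bounds end1 by (auto simp: p_eq(2))
    show ?case
      using pos_moebius_comp[OF K(1) pos_f1 side] K(2) f_mem01 unfolding f1_def
      by (metis atLeastAtMost_iff)
  qed
  then show ?thesis
    using that by blast
qed

lemma cylinder_mem: "cylinder n k \<Longrightarrow> x \<in> {0..1} \<Longrightarrow> k x \<in> {0..1}"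
proof (induction arbitrary: x rule: cylinder.induct)
  case (left n k)
  from left.IH[OF f_mem01(1)[OF left.prems]] show ?case .
next
  case (right n k)
  from right.IH[OF f_mem01(2)[OF right.prems]] show ?case .
qed

lemma cylinder_mono: "cylinder n k \<Longrightarrow> 0 \<le> x \<Longrightarrow> x \<le> y \<Longrightarrow> y \<le> 1 \<Longrightarrow> k x \<le> k y"
  by (erule cylinder_moebius) (auto intro: pos_moebius_mono)

lemma cylinder_contraction:
  "cylinder n k \<Longrightarrow> x \<in> {0..1} \<Longrightarrow> y \<in> {0..1} \<Longrightarrow> \<bar>k x - k y\<bar> \<le> rate ^ n * \<bar>x - y\<bar>"
proof (induction arbitrary: x y rule: cylinder.induct)
  case base
  then show ?case
    by simp
next
  case (left n k)
  have "\<bar>k (f0 x) - k (f0 y)\<bar> \<le> rate ^ n * \<bar>f0 x - f0 y\<bar>"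
    using left f_mem01 by blast
  also have "\<dots> \<le> rate ^ n * (rate * \<bar>x - y\<bar>)"
    using rate_bounds left.prems by (intro mult_left_mono f_contraction) auto
  finally show ?case
    by (simp add: mult_ac)
next
  case (right n k)
  have "\<bar>k (f1 x) - k (f1 y)\<bar> \<le> rate ^ n * \<bar>f1 x - f1 y\<bar>"
    using right f_mem01 by blast
  also have "\<dots> \<le> rate ^ n * (rate * \<bar>x - y\<bar>)"
    using rate_bounds right.prems by (intro mult_left_mono f_contraction) auto
  finally show ?case
    by (simp add: mult_ac)
qed

text \<open>Every cylinder of level \<open>n\<close> has \<open>F\<close>-mass
  \<open>1 / 2 ^ n\<close>, whatever its word, and inside it \<open>F\<close> is a scaled copy of
  itself.\<close>

lemma cylinder_self_similar:
  assumes F: "self_similar F"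
  shows "cylinder n k \<Longrightarrow> x \<in> {0..1} \<Longrightarrow> F (k x) = F (k 0) + F x / 2 ^ n"
proof (induction arbitrary: x rule: cylinder.induct)
  case base
  then show ?case
    using F by (simp add: self_similar_def)
next
  case (left n k)
  have "F (k (f0 x)) = F (k 0) + F (f0 x) / 2 ^ n"
    using left f_mem01 by blast
  then show ?case
    using left.prems by (simp add: f_ends self_similarD(3)[OF F])
next
  case (right n k)
  \<comment> \<open>Kept general in \<open>y\<close>: the instance at 0 moves the base point from
    \<open>k 0\<close> to \<open>k (f1 0)\<close>. In the left case the base point stays, since
    \<open>f0 0 = 0\<close>.\<close>
  have "F (k (f1 y)) = F (k 0) + (1 + F y) / 2 / 2 ^ n" if "y \<in> {0..1}" for y
    using right.IH[of "f1 y"] that f_mem01 by (simp add: self_similarD(4)[OF F])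
  from this[of x] this[of 0] show ?case
    using right.prems by (simp add: self_similarD(1)[OF F] add_divide_distrib)
qed

text \<open>Pigeonhole: one of the two halves of a cylinder carries at most half of the additive quantity
  \<open>Q\<close>. This replaces an appeal to the Lebesgue differentiation theorem.\<close>

lemma exists_light_cylinder:
  fixes Q :: "real \<Rightarrow> real \<Rightarrow> real"
  assumes add: "\<And>x y z. 0 \<le> x \<Longrightarrow> x \<le> y \<Longrightarrow> y \<le> z \<Longrightarrow> z \<le> 1 \<Longrightarrow> Q x z = Q x y + Q y z"
  shows "\<exists>k. cylinder n k \<and> Q (k 0) (k 1) \<le> Q 0 1 / 2 ^ n"
proof (induction n)
  case 0
  show ?case
    using cylinder.base by fastforce
next
  case (Suc n)
  then obtain k where k: "cylinder n k" "Q (k 0) (k 1) \<le> Q 0 1 / 2 ^ n"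
    by blast
  have "Q (k 0) (k 1) = Q (k 0) (k p) + Q (k p) (k 1)"
    using cylinder_mem[OF k(1)] cylinder_mono[OF k(1)] p_bounds by (intro add) auto
  then consider "Q (k 0) (k p) \<le> Q 0 1 / 2 ^ Suc n" | "Q (k p) (k 1) \<le> Q 0 1 / 2 ^ Suc n"
    using k(2) by (fastforce simp: field_simps)
  then show ?case
    using cylinder.left[OF k(1)] cylinder.right[OF k(1)] f_ends by cases fastforce+
qed

section \<open>Self-similar functions with a density\<close>

text \<open>On a light cylinder \<open>h\<close> is close in mean to the constant
  \<open>g (k 0)\<close>, so \<open>F v / 2 ^ n\<close> is close to
  \<open>(k v - k 0) * g (k 0)\<close>. The error is itself of order \<open>1 / 2 ^ n\<close>, so it
  remains small after rescaling.\<close>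

lemma self_similar_approx_moebius:
  assumes F: "self_similar F"
    and h: "h absolutely_integrable_on {0..1}" "\<And>x. 0 \<le> h x"
    and Fh: "\<And>x. x \<in> {0..1} \<Longrightarrow> F x = integral {0..x} h"
    and e: "0 < e"
  obtains s where "0 < s" "s < 1" "\<And>v. v \<in> {0..1} \<Longrightarrow> \<bar>F v - normal_moebius s v\<bar> \<le> e"
proof -
  \<comment> \<open>The error on the light cylinder is at most \<open>2 * \<eta> / 2 ^ n\<close> and
    is spent twice, at \<open>v\<close> and at 1; hence the quarter.\<close>
  define \<eta> where "\<eta> = e / 4"
  have \<eta>: "0 < \<eta>"
    using e by (simp add: \<eta>_def)
  obtain g where g: "continuous_on {0..1} g" "integral {0..1} (\<lambda>x. \<bar>h x - g x\<bar>) < \<eta>"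
    using integrable_approx_continuous[OF h \<eta>] .
  obtain \<rho> where \<rho>: "0 < \<rho>" "\<And>x y. x \<in> {0..1} \<Longrightarrow> y \<in> {0..1} \<Longrightarrow> \<bar>y - x\<bar> < \<rho> \<Longrightarrow> \<bar>g y - g x\<bar> < \<eta>"
    using compact_uniformly_continuous[OF g(1)] \<eta>
    unfolding uniformly_continuous_on_def dist_real_def by (metis compact_Icc)
  \<comment> \<open>Every cylinder of level \<open>n\<close> is shorter than \<open>\<rho>\<close>,
    so \<open>g\<close> varies by less than \<open>\<eta>\<close> on it.\<close>
  obtain n where n: "rate ^ n < \<rho>"
    using real_arch_pow_inv[OF \<rho>(1) rate_bounds(2)] by blast
  have h_int: "h integrable_on {x..y}" and hg_int: "(\<lambda>z. \<bar>h z - g z\<bar>) integrable_on {x..y}"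
    if "0 \<le> x" "y \<le> 1" for x y
  proof -
    have sub: "{x..y} \<subseteq> {0..1}"
      using that by auto
    show "h integrable_on {x..y}"
      using h(1) sub set_lebesgue_integral_eq_integral(1) integrable_on_subinterval by blast
    have "(\<lambda>z. \<bar>h z - g z\<bar>) absolutely_integrable_on {0..1}"
      by (intro set_integrable_abs set_integral_diff h absolutely_integrable_continuous_real g)
    then show "(\<lambda>z. \<bar>h z - g z\<bar>) integrable_on {x..y}"
      using sub set_lebesgue_integral_eq_integral(1) integrable_on_subinterval by blast
  qed
  \<comment> \<open>The term \<open>\<eta> * (y - x)\<close> pays for the oscillation of
    \<open>g\<close>. It is additive like the integral, so one pigeonhole argument controls both
    errors.\<close>
  define Q where "Q = (\<lambda>x y. integral {x..y} (\<lambda>z. \<bar>h z - g z\<bar>) + \<eta> * (y - x))"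
  have Q_nonneg: "0 \<le> Q x y" if "0 \<le> x" "x \<le> y" "y \<le> 1" for x y
    unfolding Q_def using that \<eta>
    by (intro add_nonneg_nonneg Henstock_Kurzweil_Integration.integral_nonneg hg_int) auto
  have Q_add: "Q x z = Q x y + Q y z" if "0 \<le> x" "x \<le> y" "y \<le> z" "z \<le> 1" for x y z
    using that Henstock_Kurzweil_Integration.integral_combine[OF that(2,3) hg_int]
    by (simp add: Q_def algebra_simps)
  obtain k where k: "cylinder n k" and Qk: "Q (k 0) (k 1) \<le> Q 0 1 / 2 ^ n"
    using exists_light_cylinder[of Q n] Q_add by blast
  define q where "q = Q (k 0) (k 1)"
  have "Q 0 1 \<le> 2 * \<eta>"
    using g(2) by (simp add: Q_def)
  then have "Q 0 1 / 2 ^ n \<le> 2 * \<eta> / 2 ^ n"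
    by (intro divide_right_mono) auto
  with Qk have q: "q \<le> 2 * \<eta> / 2 ^ n"
    by (simp add: q_def)
  have near: "\<bar>F v / 2 ^ n - (k v - k 0) * g (k 0)\<bar> \<le> q" if v: "v \<in> {0..1}" for v
  proof -
    have k0: "0 \<le> k 0" "k 0 \<le> 1" and kv: "k 0 \<le> k v" "k v \<le> k 1" "k 1 \<le> 1" "k v \<le> 1"
      using cylinder_mem[OF k, of 0] cylinder_mem[OF k, of 1] cylinder_mem[OF k, of v]
        cylinder_mono[OF k, of 0 v] cylinder_mono[OF k, of v 1] v by auto
    have "F v / 2 ^ n = F (k v) - F (k 0)"
      using cylinder_self_similar[OF F k v] by simp
    also have "\<dots> = integral {k 0..k v} h"
      using Henstock_Kurzweil_Integration.integral_combine[OF k0(1) kv(1) h_int] kv k0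
      by (simp add: Fh)
    finally have eq: "F v / 2 ^ n - (k v - k 0) * g (k 0) = integral {k 0..k v} (\<lambda>z. h z - g (k 0))"
      using kv k0 by (subst Henstock_Kurzweil_Integration.integral_diff) (auto intro!: h_int)
    have "norm (integral {k 0..k v} (\<lambda>z. h z - g (k 0))) \<le>
        integral {k 0..k v} (\<lambda>z. \<bar>h z - g z\<bar> + \<eta>)"
    proof (rule integral_norm_bound_integral)
      show "(\<lambda>z. h z - g (k 0)) integrable_on {k 0..k v}"
        using k0 kv by (intro integrable_diff h_int integrable_const_ivl) auto
      show "(\<lambda>z. \<bar>h z - g z\<bar> + \<eta>) integrable_on {k 0..k v}"
        using k0 kv by (intro integrable_add hg_int integrable_const_ivl) auto
      fix z assume z: "z \<in> {k 0..k v}"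
      have "\<bar>k 1 - k 0\<bar> \<le> rate ^ n * \<bar>1 - 0\<bar>"
        by (rule cylinder_contraction[OF k]) auto
      then have "\<bar>z - k 0\<bar> < \<rho>"
        using z n kv by auto
      then have "\<bar>g z - g (k 0)\<bar> < \<eta>"
        using z k0 kv by (intro \<rho>(2)) auto
      then show "norm (h z - g (k 0)) \<le> \<bar>h z - g z\<bar> + \<eta>"
        by simp
    qed
    also have "\<dots> = Q (k 0) (k v)"
      unfolding Q_def using k0 kv
      by (subst Henstock_Kurzweil_Integration.integral_add) (auto intro!: hg_int)
    also have "\<dots> \<le> q"
      using Q_add[of "k 0" "k v" "k 1"] Q_nonneg[of "k v" "k 1"] k0 kv by (simp add: q_def)
    finally show ?thesis
      by (simp add: eq)
  qed
  obtain a b c d where "pos_moebius a b c d" "\<And>x. x \<in> {0..1} \<Longrightarrow> k x = moebius a b c d x"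
    using cylinder_moebius[OF k] by blast
  then obtain s where s: "0 < s" "s < 1" and L: "k 0 < k 1"
    and M: "\<And>x. x \<in> {0..1} \<Longrightarrow> (k x - k 0) / (k 1 - k 0) = normal_moebius s x"
    using pos_moebius_normalise[of a b c d k] by (metis (no_types))
  show ?thesis
  proof (rule that[OF s])
    fix v :: real assume v: "v \<in> {0..1}"
    define m where "m = normal_moebius s v"
    have kv: "k v - k 0 = m * (k 1 - k 0)"
      using M[OF v] L by (simp add: m_def field_simps)
    have m: "0 \<le> m" "m \<le> 1"
      unfolding m_def M[OF v, symmetric]
      using L cylinder_mono[OF k, of 0 v] cylinder_mono[OF k, of v 1] v by auto
    have 1: "\<bar>F v / 2 ^ n - m * (k 1 - k 0) * g (k 0)\<bar> \<le> q"
      using near[OF v] unfolding kv .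
    \<comment> \<open>At \<open>v = 1\<close>, where \<open>F 1 = 1\<close>, the estimate shows that
      \<open>(k 1 - k 0) * g (k 0)\<close> is \<open>1 / 2 ^ n\<close> up to \<open>q\<close>; this
      eliminates the unknown \<open>g (k 0)\<close>.\<close>
    have "\<bar>m\<bar> * \<bar>1 / 2 ^ n - (k 1 - k 0) * g (k 0)\<bar> \<le> 1 * q"
      using near[of 1] m self_similarD(2)[OF F] by (intro mult_mono) auto
    then have 2: "\<bar>m / 2 ^ n - m * (k 1 - k 0) * g (k 0)\<bar> \<le> q"
      by (simp add: abs_mult[symmetric] algebra_simps)
    have "\<bar>F v - m\<bar> / 2 ^ n = \<bar>F v / 2 ^ n - m / 2 ^ n\<bar>"
      by (simp add: abs_divide flip: diff_divide_distrib)
    also have "\<dots> \<le> q + q"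
      using 1 2 by linarith
    also have "\<dots> \<le> e / 2 ^ n"
      using q by (simp add: \<eta>_def)
    finally show "\<bar>F v - normal_moebius s v\<bar> \<le> e"
      by (simp add: m_def divide_le_cancel)
  qed
qed

text \<open>A subsequence of the parameters converges to some \<open>l\<close> in [0,1]. Each
  \<open>normal_moebius t\<close> takes the value 1/2 at \<open>t\<close>, so
  \<open>F l = 1 / 2\<close>; as \<open>F 0 = 0\<close> and \<open>F 1 = 1\<close>, the degenerate
  limits 0 and 1 are excluded.\<close>

lemma self_similar_eq_moebius:
  assumes F: "self_similar F" and cont: "continuous_on {0..1} F"
    and approx: "\<And>e. 0 < e \<Longrightarrow> \<exists>s\<in>{0<..<1}. \<forall>v\<in>{0..1}. \<bar>F v - normal_moebius s v\<bar> \<le> e"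
  obtains s where "0 < s" "s < 1" "\<And>v. v \<in> {0..1} \<Longrightarrow> F v = normal_moebius s v"
proof -
  have "\<exists>s\<in>{0<..<1}. \<forall>v\<in>{0..1}. \<bar>F v - normal_moebius s v\<bar> \<le> 1 / real (Suc n)" for n
    by (rule approx) simp
  then obtain s where s: "\<And>n. s n \<in> {0<..<1}"
    and Fs: "\<And>n v. v \<in> {0..1} \<Longrightarrow> \<bar>F v - normal_moebius (s n) v\<bar> \<le> 1 / real (Suc n)"
    by metis
  have "\<And>n. s n \<in> {0..1}"
    using s by (meson greaterThanLessThan_subseteq_atLeastAtMost_iff subset_iff order_refl)
  then obtain l r where l: "l \<in> {0..1}" and r: "strict_mono r" and lim: "(s \<circ> r) \<longlonglongrightarrow> l"
    using compact_Icc[of 0 "1 :: real", unfolded compact_def] by metis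
  have err: "(\<lambda>n. 1 / real (Suc (r n))) \<longlonglongrightarrow> 0"
    using LIMSEQ_subseq_LIMSEQ[OF lim_1_over_n[THEN LIMSEQ_Suc] r] by (simp add: o_def)
  have "(\<lambda>n. F (s (r n)) - 1 / 2) \<longlonglongrightarrow> 0"
  proof (rule Lim_null_comparison[OF _ err], rule always_eventually, rule allI)
    fix n
    define t where "t = s (r n)"
    have t: "0 < t" "t < 1"
      using s[of "r n"] by (auto simp: t_def)
    have "normal_moebius t t = ((1 - t) * t) / (2 * ((1 - t) * t))"
      by (simp add: normal_moebius_def algebra_simps)
    also have "\<dots> = 1 / 2"
      using t by simp
    finally show "norm (F (s (r n)) - 1 / 2) \<le> 1 / real (Suc (r n))"
      using Fs[of t "r n"] t by (simp add: t_def)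
  qed
  moreover have "(\<lambda>n. F (s (r n)) - 1 / 2) \<longlonglongrightarrow> F l - 1 / 2"
  proof (intro tendsto_intros continuous_on_tendsto_compose[OF cont _ l])
    show "(\<lambda>n. s (r n)) \<longlonglongrightarrow> l"
      using lim by (simp add: o_def)
  qed (use \<open>\<And>n. s n \<in> {0..1}\<close> in auto)
  ultimately have "F l = 1 / 2"
    using LIMSEQ_unique by fastforce
  then have l01: "0 < l" "l < 1"
    using self_similarD(1,2)[OF F] l by (auto simp: less_le)
  show ?thesis
  proof (rule that[OF l01])
    fix v :: real assume v: "v \<in> {0..1}"
    have "(\<lambda>n. normal_moebius (s (r n)) v) \<longlonglongrightarrow> normal_moebius l v"
      unfolding normal_moebius_def using lim normal_moebius_denom_pos[OF l01 v]
      by (intro tendsto_intros) (auto simp: o_def)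
    then have "(\<lambda>n. F v - normal_moebius (s (r n)) v) \<longlonglongrightarrow> F v - normal_moebius l v"
      by (intro tendsto_intros)
    moreover have "(\<lambda>n. F v - normal_moebius (s (r n)) v) \<longlonglongrightarrow> 0"
      by (rule Lim_null_comparison[OF _ err]) (use Fs[OF v] in auto)
    ultimately show "F v = normal_moebius l v"
      using LIMSEQ_unique by fastforce
  qed
qed

text \<open>The right-hand side says that the derivatives of \<open>f0\<close> and \<open>f1\<close> at their fixed points
  \<open>0\<close> and \<open>1\<close> are \<open>1/2\<close>.\<close>

lemma self_similar_moebius_iff:
  "self_similar (normal_moebius p) \<longleftrightarrow> d0 = 2 * a0 \<and> d1 = 2 * b1 + c1"
proof -
  note p = p_bounds
  have den0: "0 < c0 * x + d0" and den1: "0 < c1 * x + d1" if "x \<in> {0..1}" for x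
    using pos0 pos1 that by (auto intro!: moebius_denom_pos)
  have f0: "f0 x \<in> {0..1}" "f0 x = a0 * x / (c0 * x + d0)"
    and f1: "f1 x \<in> {0..1}" "f1 x = (a1 * x + b1) / (c1 * x + d1)" if "x \<in> {0..1}" for x
    using f_mem01[OF that] by (auto simp: f0_def f1_def moebius_def)
  note nden = normal_moebius_denom_pos[OF p]
  have c0: "p * c0 + p * d0 = a0"
    using p_eq(1) by (simp add: algebra_simps)
  show ?thesis
  proof
    assume S: "self_similar (normal_moebius p)"
    have pp: "p \<in> {0..1}"
      using p by auto
    \<comment> \<open>Testing the two equations at the single point \<open>p\<close>, where the
      value is 1/2, already gives both conditions.\<close>
    have "normal_moebius p p = ((1 - p) * p) / (2 * ((1 - p) * p))"
      by (simp add: normal_moebius_def algebra_simps)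
    then have half: "normal_moebius p p = 1 / 2"
      using p by simp
    have "normal_moebius p (f0 p) = 1 / 4"
      using self_similarD(3)[OF S pp] half by simp
    then have "4 * ((1 - p) * f0 p) = p + (1 - 2 * p) * f0 p"
      using nden[OF f0(1)[OF pp]] unfolding normal_moebius_def by (simp add: divide_simps)
    then have "f0 p * (3 - 2 * p) = p"
      by (simp add: algebra_simps)
    then have "p * (a0 * (3 - 2 * p)) = p * (c0 * p + d0)"
      using den0[OF pp] f0(2)[OF pp] by (simp add: field_simps)
    then have "a0 * (3 - 2 * p) = c0 * p + d0"
      using p by simp
    then have "(1 - p) * (2 * a0) = (1 - p) * d0"
      using c0 by (simp add: algebra_simps)
    then have 1: "d0 = 2 * a0"
      using p by simp
    have "normal_moebius p (f1 p) = 3 / 4"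
      using self_similarD(4)[OF S pp] half by simp
    then have "4 * ((1 - p) * f1 p) = 3 * (p + (1 - 2 * p) * f1 p)"
      using nden[OF f1(1)[OF pp]] unfolding normal_moebius_def by (simp add: divide_simps)
    then have "f1 p * (1 + 2 * p) = 3 * p"
      by (simp add: algebra_simps)
    then have "(a1 * p + b1) * (1 + 2 * p) = 3 * p * (c1 * p + d1)"
      using den1[OF pp] f1(2)[OF pp] by (simp add: divide_simps)
    \<comment> \<open>Once \<open>a1\<close> and \<open>b1\<close> are expressed by
      \<open>p\<close>, \<open>c1\<close> and \<open>d1\<close>, the equation has the common factor
      \<open>p * (1 - p)\<close>.\<close>
    then have "(p * (1 - p)) * c1 = (p * (1 - p)) * (d1 * (1 - 2 * p))"
      unfolding p_eq(2,3) by algebra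
    then have "c1 = d1 * (1 - 2 * p)"
      using p by simp
    then show "d0 = 2 * a0 \<and> d1 = 2 * b1 + c1"
      using 1 by (simp add: p_eq(2) algebra_simps)
  next
    assume C: "d0 = 2 * a0 \<and> d1 = 2 * b1 + c1"
    \<comment> \<open>Given \<open>p\<close>, the conditions determine both matrices up to scalar
      factors, so \<open>f0\<close> and \<open>f1\<close> become explicit in \<open>p\<close>
      alone.\<close>
    have d1: "c1 = d1 * (1 - 2 * p)"
      using C p_eq(2) by algebra
    have pc0: "p * c0 = a0 * (1 - 2 * p)"
      using C c0 by (simp add: algebra_simps)
    show "self_similar (normal_moebius p)"
      unfolding self_similar_def
    proof (intro conjI ballI)
      show "normal_moebius p 0 = 0" "normal_moebius p 1 = 1"
        using p by (auto simp: normal_moebius_def)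
      fix x :: real assume x: "x \<in> {0..1}"
      have D: "0 < p + (1 - 2 * p) * x"
        by (rule nden[OF x])
      have "p * (c0 * x + d0) = a0 * ((1 - 2 * p) * x + 2 * p)"
        using pc0 C by algebra
      moreover have "f0 x = p * (a0 * x) / (p * (c0 * x + d0))"
        using f0(2)[OF x] p by simp
      ultimately have f0x: "f0 x = p * x / ((1 - 2 * p) * x + 2 * p)"
        using pos0 by simp
      have E: "0 < (1 - 2 * p) * x + 2 * p"
        using D p by linarith
      show "normal_moebius p (f0 x) = normal_moebius p x / 2"
      proof -
        have "p + (1 - 2 * p) * f0 x = 2 * p * (p + (1 - 2 * p) * x) / ((1 - 2 * p) * x + 2 * p)"
          using E unfolding f0x by (simp add: field_simps)
        then show ?thesis
          unfolding normal_moebius_def using p D E by (simp add: f0x)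
      qed
      have "f1 x = (d1 * ((2 - 3 * p) * x + p)) / (d1 * ((1 - 2 * p) * x + 1))"
      proof -
        have "a1 * x + b1 = d1 * ((2 - 3 * p) * x + p)" "c1 * x + d1 = d1 * ((1 - 2 * p) * x + 1)"
          using p_eq(2,3) d1 by algebra+
        then show ?thesis
          by (simp only: f1(2)[OF x])
      qed
      then have f1x: "f1 x = ((2 - 3 * p) * x + p) / ((1 - 2 * p) * x + 1)"
        using pos1 by simp
      have E: "0 < (1 - 2 * p) * x + 1"
        using D p by linarith
      show "normal_moebius p (f1 x) = (1 + normal_moebius p x) / 2"
      proof -
        have quot: "u * (N / E) / (2 * u * D / E) = N / (2 * D)"
          if "0 < E" "0 < u" "0 < D" for E u D N :: real
          using that by (simp add: field_simps)
        have "p + (1 - 2 * p) * f1 x = 2 * (1 - p) * (p + (1 - 2 * p) * x) / ((1 - 2 * p) * x + 1)"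
          using E unfolding f1x by (simp add: field_simps)
        then have "normal_moebius p (f1 x) = ((2 - 3 * p) * x + p) / (2 * (p + (1 - 2 * p) * x))"
          using quot[of "(1 - 2 * p) * x + 1" "1 - p" "p + (1 - 2 * p) * x" "(2 - 3 * p) * x + p"]
            p D E by (simp only: normal_moebius_def f1x)
        also have "\<dots> = (1 + normal_moebius p x) / 2"
          unfolding normal_moebius_def using D by (simp add: field_simps)
        finally show ?thesis .
      qed
    qed
  qed
qed

text \<open>Approximation to every accuracy makes \<open>F\<close> equal to some
  \<open>normal_moebius s\<close>. From \<open>F p = F (f0 1) = 1 / 2\<close> it follows that
  \<open>s = p\<close>, and then the equations can be tested on this explicit map.\<close>

theorem self_similar_absolutely_continuous:
  assumes F: "self_similar F"
    and h: "h absolutely_integrable_on {0..1}" "\<And>x. 0 \<le> h x"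
    and Fh: "\<And>x. x \<in> {0..1} \<Longrightarrow> F x = integral {0..x} h"
  shows "d0 = 2 * a0 \<and> d1 = 2 * b1 + c1"
proof -
  have "continuous_on {0..1} (\<lambda>x. integral {0..x} h)"
    by (intro indefinite_integral_continuous_1 set_lebesgue_integral_eq_integral h)
  then have cont: "continuous_on {0..1} F"
    using Fh by (metis (no_types, lifting) continuous_on_cong)
  have "\<exists>s\<in>{0<..<1}. \<forall>v\<in>{0..1}. \<bar>F v - normal_moebius s v\<bar> \<le> e" if "0 < e" for e
    using self_similar_approx_moebius[OF F h Fh that] by (metis greaterThanLessThan_iff)
  then obtain s where s: "0 < s" "s < 1" and Fs: "\<And>v. v \<in> {0..1} \<Longrightarrow> F v = normal_moebius s v"
    by (rule self_similar_eq_moebius[OF F cont]) blast+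
  have pp: "p \<in> {0..1}"
    using p_bounds by auto
  have "normal_moebius s p = 1 / 2"
    using self_similarD(3)[OF F, of 1] self_similarD(2)[OF F] Fs[OF pp] by (simp add: f_ends)
  then have "s = p"
    using normal_moebius_denom_pos[OF s pp] unfolding normal_moebius_def
    by (simp add: divide_simps algebra_simps)
  moreover have "self_similar (normal_moebius s)"
    unfolding self_similar_def
    using self_similarD[OF F] Fs f_mem01 by (metis atLeastAtMost_iff order_refl zero_le_one)
  ultimately show ?thesis
    using self_similar_moebius_iff by simp
qed

end

section \<open>Invariant measures\<close>

lemma borel_measurable_moebius [measurable]:
  "moebius a b c (d :: real) \<in> borel_measurable borel"
  unfolding moebius_def by measurable

text \<open>The preimage is the image of a part of \<open>N\<close> under the inverse map, given by
  the adjugate matrix. That map is differentiable there, and so preserves negligible sets.\<close>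

lemma null_sets_pos_moebius_vimage:
  assumes "pos_moebius a b c d" and N: "N \<in> null_sets lborel"
  shows "{z \<in> {0..1}. moebius a b c d z \<in> N} \<in> null_sets lborel"
proof -
  define S where "S = {z \<in> {0..1}. moebius a b c d z \<in> N}"
  have cd: "0 < d" "0 < c + d" "0 < a * d - b * c"
    using assms(1) by (auto simp: pos_moebius_def)
  have den: "0 < c * z + d" if "z \<in> S" for z
    using that moebius_denom_pos(2)[OF cd(1,2)] by (auto simp: S_def)
  have "negligible N"
    using N by (simp add: negligible_iff_null_sets null_sets_completionI)
  then have neg: "negligible (moebius a b c d ` S)"
    by (rule negligible_subset) (auto simp: S_def)
  have "moebius d (-b) (-c) a differentiable_on moebius a b c d ` S"
    unfolding differentiable_on_def
  proof (intro ballI)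
    fix w assume "w \<in> moebius a b c d ` S"
    then obtain z where z: "z \<in> S" "w = moebius a b c d z"
      by auto
    \<comment> \<open>The denominator of the inverse map at \<open>w\<close> is the determinant over
      the original denominator, hence nonzero.\<close>
    have "- c * w + a = (a * d - b * c) / (c * z + d)"
      unfolding z(2) moebius_def using den[OF z(1)] by (simp add: field_simps)
    then have "- c * w + a \<noteq> 0"
      using cd den[OF z(1)] by simp
    then show "moebius d (-b) (-c) a differentiable at w within moebius a b c d ` S"
      unfolding moebius_def by (intro derivative_intros) auto
  qed
  then have "negligible (moebius d (-b) (-c) a ` moebius a b c d ` S)"
    by (rule negligible_differentiable_image_negligible[OF order_refl neg])
  moreover have "S \<subseteq> moebius d (-b) (-c) a ` moebius a b c d ` S"
  proof
    fix z assume z: "z \<in> S"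
    have "moebius d (-b) (-c) a (moebius a b c d z) = z"
      using cd den[OF z] by (intro moebius_inverse) auto
    then show "z \<in> moebius d (-b) (-c) a ` moebius a b c d ` S"
      using z by (metis imageI)
  qed
  ultimately have "negligible S"
    by (rule negligible_subset)
  moreover have [measurable]: "N \<in> sets borel"
    using N by auto
  have "S \<in> sets borel"
    unfolding S_def by measurable
  ultimately show ?thesis
    by (simp add: negligible_iff_null_sets null_sets_completion_iff S_def)
qed

text \<open>The union of null sets whose masses approach the supremum attains it. Such a set carries
  the whole singular part, which gives the Lebesgue decomposition by one set.\<close>

lemma exists_maximal_null_set:
  assumes "finite_measure \<nu>" and sets: "sets \<nu> = sets M"
  obtains N where "N \<in> null_sets M" "\<And>E. E \<in> null_sets M \<Longrightarrow> measure \<nu> E \<le> measure \<nu> N"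
proof -
  interpret finite_measure \<nu> by fact
  define s where "s = (SUP E\<in>null_sets M. measure \<nu> E)"
  have bdd: "bdd_above (measure \<nu> ` null_sets M)"
    by (rule bdd_aboveI2[where M = "measure \<nu> (space \<nu>)"]) (rule bounded_measure)
  have ub: "measure \<nu> E \<le> s" if "E \<in> null_sets M" for E
    unfolding s_def using that bdd by (rule cSUP_upper)
  have "\<exists>E\<in>null_sets M. s - 1 / real (Suc n) < measure \<nu> E" for n
  proof -
    have "null_sets M \<noteq> {}"
      by (metis empty_iff null_sets.empty_sets)
    then have "s - 1 / real (Suc n) < s \<Longrightarrow> ?thesis"
      unfolding s_def by (subst (asm) less_cSUP_iff) (use bdd in auto)
    then show ?thesis
      by simp
  qed
  then obtain N where N: "\<And>n. N n \<in> null_sets M" "\<And>n. s - 1 / real (Suc n) < measure \<nu> (N n)"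
    by metis
  have null: "(\<Union>n. N n) \<in> null_sets M"
    using N by (intro null_sets_UN) auto
  have "s \<le> measure \<nu> (\<Union>n. N n)"
  proof (rule field_le_epsilon)
    fix e :: real assume "0 < e"
    then obtain n where n: "1 / real (Suc n) < e"
      using nat_approx_posE by blast
    have "measure \<nu> (N n) \<le> measure \<nu> (\<Union>n. N n)"
      using null by (intro finite_measure_mono) (auto simp: sets)
    then show "s \<le> measure \<nu> (\<Union>n. N n) + e"
      using N(2)[of n] n by linarith
  qed
  then show ?thesis
    using ub null that[of "\<Union>n. N n"] by (meson order_trans)
qed

section \<open>Invariant measures and their distribution functions\<close>

context moebius_ifs
begin

definition pre0 :: "real set \<Rightarrow> real set" where "pre0 E = {z \<in> {0..1}. f0 z \<in> E}"
definition pre1 :: "real set \<Rightarrow> real set" where "pre1 E = {z \<in> {0..1}. f1 z \<in> E}"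

lemma borel_measurable_f [measurable]: "f0 \<in> borel_measurable borel" "f1 \<in> borel_measurable borel"
  unfolding f0_def f1_def by measurable

lemma sets_pre [measurable]:
  assumes [measurable]: "E \<in> sets borel"
  shows "pre0 E \<in> sets borel" "pre1 E \<in> sets borel"
  unfolding pre0_def pre1_def by measurable

lemma pre_Diff: "pre0 (E - N) = pre0 E - pre0 N" "pre1 (E - N) = pre1 E - pre1 N"
  by (auto simp: pre0_def pre1_def)

lemma pre_null_sets:
  "N \<in> null_sets lborel \<Longrightarrow> pre0 N \<in> null_sets lborel"
  "N \<in> null_sets lborel \<Longrightarrow> pre1 N \<in> null_sets lborel"
  unfolding pre0_def pre1_def f0_def f1_def
  by (auto intro!: null_sets_pos_moebius_vimage[simplified] pos_f0 pos_f1)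

text \<open>Stationarity on the whole line, for measures concentrated on [0,1]. The total mass is
  left free so that the absolutely continuous part, possibly zero, also qualifies.\<close>

definition invariant :: "real measure \<Rightarrow> bool" where
  "invariant \<kappa> \<longleftrightarrow> finite_measure \<kappa> \<and> sets \<kappa> = sets borel \<and> measure \<kappa> (- {0..1}) = 0 \<and>
    (\<forall>E\<in>sets borel. measure \<kappa> E = (measure \<kappa> (pre0 E) + measure \<kappa> (pre1 E)) / 2)"

text \<open>Evaluate invariance on the half-lines up to \<open>f0 x\<close> and \<open>f1 x\<close>.
  Points shared by the two images cause no trouble, because there is no atom at 0: \<open>f0\<close>
  sends only 0 to 0 and \<open>f1\<close> misses 0, so the mass at 0 is at most half of
  itself.\<close>

lemma invariant_self_similar:
  assumes \<kappa>: "invariant \<kappa>" and m: "measure \<kappa> UNIV \<noteq> 0"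
  shows "self_similar (\<lambda>x. measure \<kappa> {..x} / measure \<kappa> UNIV)"
    and "x \<in> {0..1} \<Longrightarrow> measure \<kappa> {..x} = measure \<kappa> {0..x}"
proof -
  interpret finite_measure \<kappa>
    using \<kappa> by (simp add: invariant_def)
  have [simp]: "sets \<kappa> = sets borel"
    using \<kappa> by (simp add: invariant_def)
  have outside: "measure \<kappa> (- {0..1}) = 0"
    and inv: "\<And>E. E \<in> sets borel \<Longrightarrow> measure \<kappa> E = (measure \<kappa> (pre0 E) + measure \<kappa> (pre1 E)) / 2"
    using \<kappa> by (auto simp: invariant_def)
  have cap: "measure \<kappa> E = measure \<kappa> (E \<inter> {0..1})" if [measurable]: "E \<in> sets borel" for E
  proof -
    have "measure \<kappa> E = measure \<kappa> (E \<inter> {0..1}) + measure \<kappa> (E - {0..1})"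
      by (subst finite_measure_Union[symmetric]) (auto intro!: arg_cong[where f = "measure \<kappa>"])
    moreover have "measure \<kappa> (E - {0..1}) \<le> measure \<kappa> (- {0..1})"
      by (intro finite_measure_mono) auto
    ultimately show ?thesis
      using outside measure_nonneg[of \<kappa> "E - {0..1}"] by linarith
  qed
  have le0: "f0 x \<le> f0 y \<longleftrightarrow> x \<le> y" and le1: "f1 x \<le> f1 y \<longleftrightarrow> x \<le> y"
    if "x \<in> {0..1}" "y \<in> {0..1}" for x y
    unfolding f0_def f1_def using pos_moebius_le_iff[OF pos_f0 that] pos_moebius_le_iff[OF pos_f1 that]
    by auto
  have "pre0 {0} \<subseteq> {0}"
    using le0[of _ 0] f_ends by (force simp: pre0_def)
  then have "measure \<kappa> (pre0 {0}) \<le> measure \<kappa> {0}"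
    by (intro finite_measure_mono) auto
  moreover have "pre1 {0} = {}"
    using f1_mem p_bounds by (force simp: pre1_def)
  then have "measure \<kappa> (pre1 {0}) = 0"
    by simp
  moreover have "measure \<kappa> {0} = (measure \<kappa> (pre0 {0}) + measure \<kappa> (pre1 {0})) / 2"
    by (rule inv) simp
  ultimately have "measure \<kappa> {0} \<le> 0"
    by (simp add: field_simps)
  then have zero: "measure \<kappa> {0} = 0"
    by (simp add: measure_le_0_iff)
  have start: "measure \<kappa> {..x} = measure \<kappa> {0..x}" if "x \<in> {0..1}" for x
  proof -
    have eq: "{..x} \<inter> {0..1} = {0..x}"
      using that by auto
    show ?thesis
      using cap[of "{..x}"] unfolding eq by simp
  qed
  show "measure \<kappa> {..x} = measure \<kappa> {0..x}" if "x \<in> {0..1}"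
    using start[OF that] .
  have total: "measure \<kappa> {0..1} = measure \<kappa> UNIV"
    using cap[of UNIV] by simp
  have eq0: "measure \<kappa> {..f0 x} = measure \<kappa> {..x} / 2" if x: "x \<in> {0..1}" for x
  proof -
    have "pre0 {..f0 x} = {0..x}"
      using le0[OF _ x] x by (auto simp: pre0_def)
    \<comment> \<open>The point 0 does occur when \<open>x = 1\<close>, because
      \<open>f0 1 = f1 0\<close>.\<close>
    moreover have "pre1 {..f0 x} \<subseteq> {0}"
    proof
      fix z assume z: "z \<in> pre1 {..f0 x}"
      then have "f1 z \<le> f1 0"
        using f0_mem[OF x] by (auto simp: pre1_def f_ends)
      then show "z \<in> {0}"
        using le1[of z 0] z by (auto simp: pre1_def)
    qed
    then have "measure \<kappa> (pre1 {..f0 x}) \<le> measure \<kappa> {0}"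
      by (intro finite_measure_mono) auto
    ultimately show ?thesis
      using inv[of "{..f0 x}"] zero start[OF x] measure_nonneg[of \<kappa> "pre1 {..f0 x}"] by simp
  qed
  have eq1: "measure \<kappa> {..f1 x} = (measure \<kappa> UNIV + measure \<kappa> {..x}) / 2" if x: "x \<in> {0..1}" for x
  proof -
    have "pre1 {..f1 x} = {0..x}"
      using le1[OF _ x] x by (auto simp: pre1_def)
    moreover have "pre0 {..f1 x} = {0..1}"
      using f0_mem f1_mem[OF x] by (fastforce simp: pre0_def)
    ultimately show ?thesis
      using inv[of "{..f1 x}"] start[OF x] total by simp
  qed
  show "self_similar (\<lambda>x. measure \<kappa> {..x} / measure \<kappa> UNIV)"
    unfolding self_similar_def
  proof (intro conjI ballI)
    show "measure \<kappa> {..0} / measure \<kappa> UNIV = 0"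
      using start[of 0] zero by simp
    show "measure \<kappa> {..1} / measure \<kappa> UNIV = 1"
      using start[of 1] total m by simp
  next
    fix x :: real assume x: "x \<in> {0..1}"
    show "measure \<kappa> {..f0 x} / measure \<kappa> UNIV = measure \<kappa> {..x} / measure \<kappa> UNIV / 2"
      by (simp add: eq0[OF x])
    show "measure \<kappa> {..f1 x} / measure \<kappa> UNIV = (1 + measure \<kappa> {..x} / measure \<kappa> UNIV) / 2"
      using eq1[OF x] m by (simp add: field_simps)
  qed
qed

section \<open>Absolutely continuous and singular invariant measures\<close>

text \<open>The real nonnegative version of the Radon-Nikodym derivative, divided by the total mass,
  is the density of the self-similar distribution function.\<close>

lemma invariant_absolutely_continuous:
  assumes \<kappa>: "invariant \<kappa>" and m: "measure \<kappa> UNIV \<noteq> 0"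
    and ac: "absolutely_continuous lborel \<kappa>"
  shows "d0 = 2 * a0 \<and> d1 = 2 * b1 + c1"
proof -
  have fin: "finite_measure \<kappa>" and sets: "sets \<kappa> = sets borel"
    using \<kappa> by (auto simp: invariant_def)
  have sets': "sets \<kappa> = sets lborel"
    using sets by simp
  obtain D where D [measurable]: "D \<in> borel_measurable lborel"
    and RN: "AE x in lborel. RN_deriv lborel \<kappa> x = ennreal (D x)" and nonneg: "\<And>x. 0 \<le> D x"
    by (rule sigma_finite_measure.real_RN_deriv[OF sigma_finite_lborel fin ac sets']) (rule that)
  have "\<kappa> = density lborel (RN_deriv lborel \<kappa>)"
    using sigma_finite_measure.density_RN_deriv[OF sigma_finite_lborel ac] sets by simp
  also have "\<dots> = density lborel (\<lambda>x. ennreal (D x))"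
    using RN by (intro density_cong) auto
  finally have dens: "\<kappa> = density lborel (\<lambda>x. ennreal (D x))" .
  define m where "m = measure \<kappa> UNIV"
  have "emeasure \<kappa> UNIV = (\<integral>\<^sup>+x. ennreal (D x) \<partial>lborel)"
    by (subst dens) (simp add: emeasure_density)
  then have "(\<integral>\<^sup>+x. ennreal (D x) \<partial>lborel) < \<infinity>"
    using finite_measure.emeasure_finite[OF fin, of UNIV] by (simp add: less_top)
  then have D_int: "integrable lborel D"
    using nonneg by (intro integrableI_bounded) (auto simp: abs_of_nonneg)
  have D_set: "set_integrable lborel A D" if "A \<in> sets borel" for A
    unfolding set_integrable_def using D_int that by (intro integrable_mult_indicator) auto
  have meas: "measure \<kappa> {0..x} = integral {0..x} D" for x
  proof -
    have "measure \<kappa> {0..x} = enn2real (\<integral>\<^sup>+z. ennreal (indicator {0..x} z * D z) \<partial>lborel)"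
      unfolding measure_def
      by (subst dens) (auto simp: emeasure_density intro!: arg_cong[where f = enn2real] nn_integral_cong
          split: split_indicator)
    also have "\<dots> = (LINT z|lborel. indicator {0..x} z * D z)"
      using nonneg by (intro integral_eq_nn_integral[symmetric]) auto
    also have "\<dots> = integral {0..x} D"
      using set_borel_integral_eq_integral(2)[OF D_set[of "{0..x}"]]
      by (simp add: set_lebesgue_integral_def)
    finally show ?thesis .
  qed
  show ?thesis
  proof (rule self_similar_absolutely_continuous)
    show "self_similar (\<lambda>x. measure \<kappa> {..x} / m)"
      unfolding m_def by (rule invariant_self_similar[OF \<kappa> m])
    have "D absolutely_integrable_on {0..1}"
      using D_set[of "{0..1}"] by (simp add: set_integrable_def integrable_completion)
    then show "(\<lambda>x. D x / m) absolutely_integrable_on {0..1}"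
      by (rule set_integrable_divide)
    show "0 \<le> D x / m" for x
      using nonneg by (simp add: m_def)
    show "measure \<kappa> {..x} / m = integral {0..x} (\<lambda>x. D x / m)" if "x \<in> {0..1}" for x
      using invariant_self_similar(2)[OF \<kappa> m that] meas[of x] by simp
  qed
qed

text \<open>Here \<open>\<kappa>\<close> is the absolutely continuous part of \<open>\<nu>\<close>. Null sets pull back to null sets, so
  \<open>\<kappa>\<close> dominates its own average under the two maps; applying this to a set and to its complement
  gives equality, the total masses being the same.\<close>

lemma invariant_restrict_maximal_null:
  assumes \<nu>: "invariant \<nu>" and N: "N \<in> null_sets lborel"
    and max: "\<And>E. E \<in> null_sets lborel \<Longrightarrow> measure \<nu> E \<le> measure \<nu> N"
  defines "\<kappa> \<equiv> density \<nu> (indicator (- N))"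
  shows "invariant \<kappa>" "absolutely_continuous lborel \<kappa>" "\<And>E. E \<in> sets borel \<Longrightarrow> measure \<kappa> E = measure \<nu> (E - N)"
proof -
  interpret finite_measure \<nu>
    using \<nu> by (simp add: invariant_def)
  have [simp, measurable_cong]: "sets \<nu> = sets borel"
    using \<nu> by (simp add: invariant_def)
  have outside: "measure \<nu> (- {0..1}) = 0"
    and inv: "\<And>E. E \<in> sets borel \<Longrightarrow> measure \<nu> E = (measure \<nu> (pre0 E) + measure \<nu> (pre1 E)) / 2"
    using \<nu> by (auto simp: invariant_def)
  have [measurable]: "N \<in> sets borel"
    using N by auto
  have em: "emeasure \<kappa> E = emeasure \<nu> (E - N)" if [measurable]: "E \<in> sets borel" for E
  proof -
    have "emeasure \<kappa> E = (\<integral>\<^sup>+x. indicator (- N) x * indicator E x \<partial>\<nu>)"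
      unfolding \<kappa>_def by (subst emeasure_density) auto
    also have "\<dots> = (\<integral>\<^sup>+x. indicator (E - N) x \<partial>\<nu>)"
      by (intro nn_integral_cong) (auto split: split_indicator)
    finally show ?thesis
      by simp
  qed
  show meas: "measure \<kappa> E = measure \<nu> (E - N)" if "E \<in> sets borel" for E
    using em[OF that] by (simp add: measure_def)
  have sets [simp, measurable_cong]: "sets \<kappa> = sets borel"
    by (simp add: \<kappa>_def)
  interpret \<kappa>: finite_measure \<kappa>
  proof
    have "space \<kappa> = UNIV"
      using sets_eq_imp_space_eq[OF sets] by simp
    then show "emeasure \<kappa> (space \<kappa>) \<noteq> \<infinity>"
      using em[of UNIV] by simp
  qed
  \<comment> \<open>If \<open>E - N\<close> had positive mass, the union of \<open>N\<close> and
    \<open>E\<close> would be a heavier null set.\<close>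
  have null: "measure \<kappa> E = 0" if E: "E \<in> null_sets lborel" for E
  proof -
    have [measurable]: "E \<in> sets borel"
      using E by auto
    have "measure \<nu> (N \<union> (E - N)) = measure \<nu> N + measure \<nu> (E - N)"
      by (intro finite_measure_Union) auto
    moreover have "measure \<nu> (N \<union> (E - N)) \<le> measure \<nu> N"
      using N E by (intro max) (auto simp: Un_Diff_cancel)
    ultimately show ?thesis
      using meas[of E] measure_nonneg[of \<nu> "E - N"] by simp
  qed
  show "absolutely_continuous lborel \<kappa>"
    unfolding absolutely_continuous_def
    using null by (auto simp: null_sets_def \<kappa>.emeasure_eq_measure)
  \<comment> \<open>Removing a null set costs \<open>\<kappa>\<close> nothing. It will be applied to
    the preimages of \<open>N\<close>, which are null but need not lie in \<open>N\<close>.\<close>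
  have drop: "measure \<kappa> A \<le> measure \<nu> (A - N')" if A [measurable]: "A \<in> sets borel"
    and N': "N' \<in> null_sets lborel" for A N'
  proof -
    have [measurable]: "N' \<in> sets borel"
      using N' by auto
    have "measure \<kappa> A = measure \<kappa> (A \<inter> N') + measure \<kappa> (A - N')"
      by (subst \<kappa>.finite_measure_Union[symmetric]) (auto intro!: arg_cong[where f = "measure \<kappa>"])
    also have "measure \<kappa> (A \<inter> N') \<le> measure \<kappa> N'"
      by (intro \<kappa>.finite_measure_mono) auto
    also have "measure \<kappa> N' = 0"
      by (rule null[OF N'])
    also have "measure \<kappa> (A - N') = measure \<nu> (A - N' - N)"
      by (rule meas) auto
    also have "\<dots> \<le> measure \<nu> (A - N')"
      by (intro finite_measure_mono) auto
    finally show ?thesis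
      by simp
  qed
  have super: "(measure \<kappa> (pre0 E) + measure \<kappa> (pre1 E)) / 2 \<le> measure \<kappa> E"
    if [measurable]: "E \<in> sets borel" for E
    using meas[of E] inv[of "E - N"] drop[of "pre0 E" "pre0 N"] drop[of "pre1 E" "pre1 N"]
      pre_null_sets N by (simp add: pre_Diff)
  have "measure \<kappa> (- {0..1}) \<le> measure \<nu> (- {0..1})"
    unfolding meas[of "- {0..1}", simplified] by (intro finite_measure_mono) auto
  then have outside': "measure \<kappa> (- {0..1}) = 0"
    using outside measure_nonneg[of \<kappa> "- {0..1}"] by linarith
  have compl: "measure \<kappa> A + measure \<kappa> (- A) = measure \<kappa> UNIV" if "A \<in> sets borel" for A
    using that by (subst \<kappa>.finite_measure_Union[symmetric]) auto
  have total: "measure \<kappa> {0..1} = measure \<kappa> UNIV"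
    using compl[of "{0..1}"] outside' by simp
  have compl': "measure \<kappa> (pre0 E) + measure \<kappa> (pre0 (- E)) = measure \<kappa> UNIV"
    "measure \<kappa> (pre1 E) + measure \<kappa> (pre1 (- E)) = measure \<kappa> UNIV"
    if [measurable]: "E \<in> sets borel" for E
    unfolding total[symmetric]
    by (subst \<kappa>.finite_measure_Union[symmetric];
        auto simp: pre0_def[abs_def] pre1_def[abs_def] intro!: arg_cong[where f = "measure \<kappa>"])+
  have "measure \<kappa> E = (measure \<kappa> (pre0 E) + measure \<kappa> (pre1 E)) / 2"
    if [measurable]: "E \<in> sets borel" for E
    using super[of E] super[of "- E"] compl[of E] compl'[of E] by simp
  then show "invariant \<kappa>"
    unfolding invariant_def using outside' \<kappa>.finite_measure_axioms by simp
qed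

text \<open>If the part of \<open>\<nu>\<close> off the maximal null set had positive mass, it would
  be invariant and absolutely continuous, which forces the excluded conditions.\<close>

lemma invariant_singular:
  assumes \<nu>: "invariant \<nu>" and C: "\<not> (d0 = 2 * a0 \<and> d1 = 2 * b1 + c1)"
  obtains N where "N \<in> null_sets lborel" "measure \<nu> (- N) = 0"
proof -
  have "finite_measure \<nu>" "sets \<nu> = sets lborel"
    using \<nu> by (auto simp: invariant_def)
  then obtain N where N: "N \<in> null_sets lborel"
    "\<And>E. E \<in> null_sets lborel \<Longrightarrow> measure \<nu> E \<le> measure \<nu> N"
    using exists_maximal_null_set by blast
  note \<kappa> = invariant_restrict_maximal_null[OF \<nu> N]
  have "measure \<nu> (UNIV - N) = 0"
    using invariant_absolutely_continuous[OF \<kappa>(1) _ \<kappa>(2)] C \<kappa>(3)[of UNIV] by auto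
  then show ?thesis
    using N(1) that by (simp add: Compl_eq_Diff_UNIV)
qed

text \<open>Under the conditions \<open>normal_moebius p\<close> solves the equations, so by
  uniqueness it is the distribution function of \<open>\<nu>\<close> on [0,1]. Equality of
  distribution functions then identifies \<open>\<nu>\<close> with a measure given by a
  density.\<close>

lemma invariant_moebius_density:
  assumes \<nu>: "invariant \<nu>" and prob: "measure \<nu> UNIV = 1"
    and C: "d0 = 2 * a0" "d1 = 2 * b1 + c1"
  shows "absolutely_continuous lborel \<nu>"
proof -
  interpret finite_measure \<nu>
    using \<nu> by (simp add: invariant_def)
  have sets [simp]: "sets \<nu> = sets borel"
    using \<nu> by (simp add: invariant_def)
  \<comment> \<open>The derivative of \<open>normal_moebius p\<close> on [0,1].\<close>
  define \<rho> where "\<rho> = (\<lambda>x. p * (1 - p) / (p + (1 - 2 * p) * x)\<^sup>2)"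
  have [measurable]: "\<rho> \<in> borel_measurable borel"
    unfolding \<rho>_def by measurable
  define \<kappa> where "\<kappa> = density lborel (\<lambda>x. ennreal (\<rho> x) * indicator {0..1} x)"
  have [simp]: "sets \<kappa> = sets borel"
    by (simp add: \<kappa>_def)
  have C': "self_similar (normal_moebius p)"
    using C self_similar_moebius_iff by simp
  have deriv: "DERIV (normal_moebius p) x :> \<rho> x" if "x \<in> {0..1}" for x
  proof -
    have "0 < p + (1 - 2 * p) * x"
      using normal_moebius_denom_pos[OF p_bounds that] .
    then show ?thesis
      unfolding normal_moebius_def[abs_def] \<rho>_def
      by (auto intro!: derivative_eq_intros simp: power2_eq_square field_simps)
  qed
  have \<rho>_nonneg: "0 \<le> \<rho> x" for x
    using p_bounds by (simp add: \<rho>_def)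
  have mob0: "normal_moebius p 0 = 0" and mob1: "normal_moebius p 1 = 1"
    using self_similarD[OF C'] by auto
  have FTC: "(\<integral>\<^sup>+x. ennreal (\<rho> x) * indicator {0..y} x \<partial>lborel) = ennreal (normal_moebius p y)"
    if "y \<in> {0..1}" for y
    using nn_integral_FTC_Icc[of \<rho> 0 y "normal_moebius p"] deriv \<rho>_nonneg that mob0 by auto
  have cdf_\<kappa>: "emeasure \<kappa> {..y} = (if y < 0 then 0 else ennreal (normal_moebius p (min y 1)))" for y
  proof -
    have "emeasure \<kappa> {..y} = (\<integral>\<^sup>+x. ennreal (\<rho> x) * indicator {0..1} x * indicator {..y} x \<partial>lborel)"
      unfolding \<kappa>_def by (subst emeasure_density) auto
    also have "\<dots> = (\<integral>\<^sup>+x. ennreal (\<rho> x) * indicator {0..min y 1} x \<partial>lborel)"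
      by (intro nn_integral_cong) (auto split: split_indicator)
    finally show ?thesis
      using FTC[of "min y 1"] by auto
  qed
  have "emeasure \<kappa> UNIV = (\<integral>\<^sup>+x. ennreal (\<rho> x) * indicator {0..1} x \<partial>lborel)"
    unfolding \<kappa>_def by (subst emeasure_density) auto
  then have "emeasure \<kappa> UNIV = 1"
    using FTC[of 1] mob1 by simp
  then have \<kappa>_fin: "finite_measure \<kappa>"
    by (intro finite_measureI) (simp add: \<kappa>_def)
  have unit: "normal_moebius p y \<in> {0..1}" if "y \<in> {0..1}" for y
  proof -
    have "0 < p + (1 - 2 * p) * y" "(1 - p) * y \<le> p + (1 - 2 * p) * y"
      using normal_moebius_denom_pos[OF p_bounds that] that p_bounds
        mult_left_mono[of y 1 p] by (auto simp: algebra_simps)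
    then show ?thesis
      using that p_bounds by (auto simp: normal_moebius_def)
  qed
  have cdf_\<nu>: "measure \<nu> {..y} = (if y < 0 then 0 else normal_moebius p (min y 1))" for y
  proof -
    have S: "self_similar (\<lambda>x. measure \<nu> {..x})"
      using invariant_self_similar(1)[OF \<nu>] prob by simp
    have le1: "measure \<nu> A \<le> 1" for A
      using bounded_measure[of A] sets_eq_imp_space_eq[OF sets] prob by simp
    have mid: "measure \<nu> {..y} = normal_moebius p y" if "y \<in> {0..1}" for y
      using S C' unit le1 that by (intro self_similar_unique) auto
    consider "y < 0" | "y \<in> {0..1}" | "1 < y"
      by fastforce
    then show ?thesis
    proof cases
      case 1
      have "measure \<nu> {..y} \<le> measure \<nu> {..0}"
        using 1 by (intro finite_measure_mono) auto
      then show ?thesis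
        using mid[of 0] mob0 measure_nonneg[of \<nu> "{..y}"] 1 by simp
    next
      case 2
      then show ?thesis
        using mid[of y] by auto
    next
      case 3
      have "measure \<nu> {..1} \<le> measure \<nu> {..y}"
        using 3 by (intro finite_measure_mono) auto
      then show ?thesis
        using mid[of 1] mob1 le1[of "{..y}"] 3 by simp
    qed
  qed
  have "cdf \<nu> = cdf \<kappa>"
  proof
    fix y
    have "0 \<le> normal_moebius p (min y 1)" if "\<not> y < 0"
      using unit[of "min y 1"] that by auto
    then show "cdf \<nu> y = cdf \<kappa> y"
      using cdf_\<kappa>[of y] cdf_\<nu>[of y] by (auto simp: cdf_def measure_def)
  qed
  then have "\<nu> = \<kappa>"
    using \<kappa>_fin finite_measure_axioms
    by (intro cdf_unique') (auto simp: finite_borel_measure_def finite_borel_measure_axioms_def)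
  then show ?thesis
    unfolding \<kappa>_def by (simp add: absolutely_continuousI_density)
qed

end

section \<open>Stationary measures for two equally weighted matrices\<close>

text \<open>The two atoms exhaust the mass, so \<open>g\<close> agrees almost everywhere with a
  combination of their indicators.\<close>

lemma nn_integral_two_atoms:
  assumes "prob_space \<mu>" "measure \<mu> {A} = 1 / 2" "measure \<mu> {B} = 1 / 2" "A \<noteq> B"
  shows "(\<integral>\<^sup>+x. g x \<partial>\<mu>) = (g A + g B) / 2"
proof -
  interpret prob_space \<mu> by fact
  have half: "ennreal (1 / 2) = inverse 2"
    using inverse_ennreal[of 2] by (simp only: inverse_eq_divide ennreal_numeral)
  \<comment> \<open>Sets outside the sigma-algebra have measure 0 by convention, so positive mass
    makes the singletons measurable.\<close>
  have A [measurable]: "{A} \<in> sets \<mu>" and B [measurable]: "{B} \<in> sets \<mu>"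
    using assms measure_notin_sets[of "{A}" \<mu>] measure_notin_sets[of "{B}" \<mu>] by auto
  have "prob ({A} \<union> {B}) = prob {A} + prob {B}"
    using assms(4) by (intro finite_measure_Union A B) auto
  then have "prob ({A} \<union> {B}) = 1"
    using assms(2,3) by simp
  then have "AE x in \<mu>. x \<in> {A} \<union> {B}"
    by (rule prob_eq_1[OF sets.Un[OF A B], THEN iffD1])
  then have "(\<integral>\<^sup>+x. g x \<partial>\<mu>) = (\<integral>\<^sup>+x. g A * indicator {A} x + g B * indicator {B} x \<partial>\<mu>)"
    using assms(4) by (intro nn_integral_cong_AE) (auto elim!: eventually_mono)
  also have "\<dots> = g A * emeasure \<mu> {A} + g B * emeasure \<mu> {B}"
    by (simp add: nn_integral_add nn_integral_cmult_indicator)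
  also have "\<dots> = (g A + g B) / 2"
    unfolding emeasure_eq_measure assms(2,3) half divide_ennreal_def by (simp only: distrib_right)
  finally show ?thesis .
qed

text \<open>The push-forward along the inclusion of [0,1] allows the rest of the argument to work
  with Borel sets of the line.\<close>

lemma stationary_invariant:
  assumes "moebius_ifs a0 c0 d0 a1 b1 c1 d1"
    and mu: "prob_space \<mu>" "measure \<mu> {mat22 a0 0 c0 d0} = 1 / 2" "measure \<mu> {mat22 a1 b1 c1 d1} = 1 / 2"
    and nu: "stationary \<mu> \<nu>"
  defines "\<nu>' \<equiv> distr \<nu> borel (\<lambda>x. x)"
  shows "moebius_ifs.invariant a0 c0 d0 a1 b1 c1 d1 \<nu>'"
    and "\<And>E. E \<in> sets borel \<Longrightarrow> emeasure \<nu>' E = emeasure \<nu> (E \<inter> {0..1})"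
proof -
  interpret moebius_ifs a0 c0 d0 a1 b1 c1 d1 by fact
  have prob: "prob_space \<nu>" and sets: "sets \<nu> = sets (restrict_space borel {0..1})"
    using nu by (auto simp: stationary_def prob_measure_on_def)
  interpret \<nu>: prob_space \<nu> by fact
  have space: "space \<nu> = {0..1}"
    using sets_eq_imp_space_eq[OF sets] by (simp add: space_restrict_space)
  have id: "(\<lambda>x. x) \<in> measurable \<nu> borel"
    using measurable_restrict_space1[of "\<lambda>x. x" borel borel "{0..1 :: real}"]
    unfolding measurable_cong_sets[OF sets refl] by simp
  show em: "emeasure \<nu>' E = emeasure \<nu> (E \<inter> {0..1})" if "E \<in> sets borel" for E
    unfolding \<nu>'_def using that by (subst emeasure_distr[OF id]) (auto simp: space)
  interpret \<nu>': prob_space \<nu>'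
    unfolding \<nu>'_def by (rule \<nu>.prob_space_distr[OF id])
  have entries: "mat22 a b c d $ 1 $ 1 = a" "mat22 a b c d $ 1 $ 2 = b"
    "mat22 a b c d $ 2 $ 1 = c" "mat22 a b c d $ 2 $ 2 = d" for a b c d
    by (simp_all add: mat22_def)
  have Phi: "Phi (mat22 a0 0 c0 d0) = f0" "Phi (mat22 a1 b1 c1 d1) = f1"
    by (rule ext, simp only: Phi_def entries f0_def f1_def)+
  \<comment> \<open>The upper right entries 0 and \<open>b1\<close> tell the two matrices apart, so
    the atoms are distinct.\<close>
  have "b1 \<noteq> 0"
    using p_eq(2) p_bounds pos1 by simp
  then have neq: "mat22 a0 0 c0 d0 \<noteq> mat22 a1 b1 c1 d1"
    using entries(2)[of a0 0 c0 d0] entries(2)[of a1 b1 c1 d1] by auto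
  have inv: "measure \<nu>' E = (measure \<nu>' (pre0 E) + measure \<nu>' (pre1 E)) / 2"
    if E: "E \<in> sets borel" for E
  proof -
    have sub: "{z \<in> {0..1}. f0 z \<in> E \<inter> {0..1}} = pre0 E \<inter> {0..1}"
      "{z \<in> {0..1}. f1 z \<in> E \<inter> {0..1}} = pre1 E \<inter> {0..1}"
    proof -
      have "\<forall>z\<in>{0..1}. f0 z \<in> {0..1} \<and> f1 z \<in> {0..1}"
        by (intro ballI conjI f_mem01)
      then show "{z \<in> {0..1}. f0 z \<in> E \<inter> {0..1}} = pre0 E \<inter> {0..1}"
        "{z \<in> {0..1}. f1 z \<in> E \<inter> {0..1}} = pre1 E \<inter> {0..1}"
        unfolding pre0_def pre1_def by blast+
    qed
    have "E \<inter> {0..1} \<in> sets \<nu>"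
      unfolding sets using E by (auto simp: sets_restrict_space)
    then have "emeasure \<nu> (E \<inter> {0..1}) =
        (\<integral>\<^sup>+h. emeasure \<nu> {z \<in> {0..1}. Phi h z \<in> E \<inter> {0..1}} \<partial>\<mu>)"
      using nu unfolding stationary_def by blast
    also have "\<dots> = (emeasure \<nu> (pre0 E \<inter> {0..1}) + emeasure \<nu> (pre1 E \<inter> {0..1})) / 2"
      unfolding nn_integral_two_atoms[OF mu neq] Phi sub ..
    finally have "emeasure \<nu>' E = (emeasure \<nu>' (pre0 E) + emeasure \<nu>' (pre1 E)) / 2"
      by (simp only: em[OF E] em[OF sets_pre(1)[OF E]] em[OF sets_pre(2)[OF E]])
    also have "\<dots> = ennreal ((measure \<nu>' (pre0 E) + measure \<nu>' (pre1 E)) / 2)"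
      by (simp add: \<nu>'.emeasure_eq_measure ennreal_divide_numeral flip: ennreal_plus)
    finally show ?thesis
      by (simp add: \<nu>'.emeasure_eq_measure)
  qed
  have "emeasure \<nu>' (- {0..1}) = 0"
    using em[of "- {0..1}"] by simp
  then have "measure \<nu>' (- {0..1}) = 0"
    by (simp add: measure_def)
  then show "invariant \<nu>'"
    unfolding invariant_def using inv \<nu>'.finite_measure_axioms by (simp add: \<nu>'_def)
qed

text \<open>The separating set and its complement would both be null for a measure of mass
  1.\<close>

lemma not_absolutely_continuous_and_mutually_singular:
  assumes "prob_space N" "sets N = sets M" "absolutely_continuous M N" "mutually_singular M N"
  shows False
proof -
  interpret prob_space N by fact
  obtain S where S: "S \<in> sets M" "emeasure M S = 0" "emeasure N (space N - S) = 0"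
    using assms(4) by (auto simp: mutually_singular_def)
  then have "emeasure N S = 0"
    using assms(3) by (auto simp: absolutely_continuous_def null_sets_def)
  then show False
    using S prob_compl[of S] assms(2) by (simp add: measure_def)
qed

theorem theorem4p3:
  fixes a0 b0 c0 d0 a1 b1 c1 d1 :: real
    and A0 A1 :: "real^2^2"
    and \<mu> :: "(real^2^2) measure"
    and \<nu> :: "real measure"
  assumes A0: "A0 = mat22 a0 b0 c0 d0"
    and A1: "A1 = mat22 a1 b1 c1 d1"
    and cond_A1: "0 = b0" "b0 < (a0 + b0) / (c0 + d0)"
      "(a0 + b0) / (c0 + d0) = b1 / d1"
      "b1 / d1 < (a1 + b1) / (c1 + d1)" "(a1 + b1) / (c1 + d1) = 1"
    and cond_A2: "a0 * d0 - b0 * c0 > 0" "a1 * d1 - b1 * c1 > 0"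
    and cond_A3: "sqrt (a0 * d0 - b0 * c0) < min d0 (c0 + d0)"
      "sqrt (a1 * d1 - b1 * c1) < min d1 (c1 + d1)"
    and mu: "prob_measure_on G \<mu>" "measure \<mu> {A0} = 1 / 2" "measure \<mu> {A1} = 1 / 2"
    and nu: "stationary \<mu> \<nu>"
  shows "(absolutely_continuous lebesgue01 \<nu> \<longleftrightarrow>
            (c0 + d0 - 2 * a0) * (d0 - a0) = a0 * c0 \<and>
            (a1 - 2 * c1) * (d1 - 2 * b1) = b1 * c1) \<and>
         (mutually_singular lebesgue01 \<nu> \<longleftrightarrow>
            (c0 + d0 - 2 * a0) * (d0 - a0) \<noteq> a0 * c0 \<or>
            (a1 - 2 * c1) * (d1 - 2 * b1) \<noteq> b1 * c1)"
proof -
  have den: "0 < d0" "0 < c0 + d0" "0 < d1" "0 < c1 + d1"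
    using real_sqrt_gt_zero[OF cond_A2(1)] real_sqrt_gt_zero[OF cond_A2(2)] cond_A3
    by linarith+
  have a0: "0 < a0" "a0 < c0 + d0"
  proof -
    show "0 < a0"
      using cond_A1(1,2) den by (simp add: zero_less_divide_iff)
    have "(a0 + b0) / (c0 + d0) < 1"
      using cond_A1 by linarith
    then show "a0 < c0 + d0"
      using den cond_A1(1) by simp
  qed
  have sqrt_less: "x < y\<^sup>2" if "sqrt x < y" "0 < x" for x y :: real
    using power_strict_mono[of "sqrt x" y 2] that by simp
  have ifs: "moebius_ifs a0 c0 d0 a1 b1 c1 d1"
  proof
    show "0 < a0" "0 < d0" "a0 < c0 + d0" "0 < d1" "0 < c1 + d1"
      by fact+
    show "b1 * c1 < a1 * d1"
      using cond_A2 by simp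
    show "a0 * d0 < d0\<^sup>2" "a0 * d0 < (c0 + d0)\<^sup>2"
      using cond_A3(1) cond_A2(1) cond_A1(1) by (auto intro!: sqrt_less)
    show "a1 * d1 - b1 * c1 < d1\<^sup>2" "a1 * d1 - b1 * c1 < (c1 + d1)\<^sup>2"
      using cond_A3(2) cond_A2(2) by (auto intro!: sqrt_less)
    show "a0 / (c0 + d0) = b1 / d1"
      using cond_A1 by simp
    show "a1 + b1 = c1 + d1"
      using cond_A1(5) den by simp
  qed
  interpret moebius_ifs a0 c0 d0 a1 b1 c1 d1 by (fact ifs)
  have i: "(c0 + d0 - 2 * a0) * (d0 - a0) = a0 * c0 \<longleftrightarrow> d0 = 2 * a0"
  proof -
    \<comment> \<open>The second factor is positive because \<open>a0 < c0 + d0\<close>.\<close>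
    have "(c0 + d0 - 2 * a0) * (d0 - a0) - a0 * c0 = (d0 - 2 * a0) * (c0 + d0 - a0)"
      by algebra
    then show ?thesis
      using a0 by (metis eq_iff_diff_eq_0 less_irrefl mult_eq_0_iff)
  qed
  have ii: "(a1 - 2 * c1) * (d1 - 2 * b1) = b1 * c1 \<longleftrightarrow> d1 = 2 * b1 + c1"
  proof -
    \<comment> \<open>The factorisation uses \<open>a1 + b1 = c1 + d1\<close>; its second factor is
      positive because \<open>b1 = p * d1\<close> with \<open>p < 1\<close>.\<close>
    have "(a1 - 2 * c1) * (d1 - 2 * b1) - b1 * c1 = (d1 - (2 * b1 + c1)) * (d1 - b1)"
      using end1 by algebra
    moreover have "b1 < d1"
      using p_eq(2) p_bounds den by simp
    ultimately show ?thesis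
      by (metis eq_iff_diff_eq_0 less_irrefl mult_eq_0_iff)
  qed
  have prob_mu: "prob_space \<mu>"
    using mu(1) by (simp add: prob_measure_on_def)
  have prob_nu: "prob_space \<nu>" and sets: "sets \<nu> = sets lebesgue01"
    using nu by (auto simp: stationary_def prob_measure_on_def intro!: sets_restrict_space_cong)
  have space: "space \<nu> = {0..1}"
    using sets_eq_imp_space_eq[OF sets] by (simp add: space_restrict_space)
  define \<nu>' where "\<nu>' = distr \<nu> borel (\<lambda>x. x)"
  have inv: "invariant \<nu>'"
    and em: "\<And>E. E \<in> sets borel \<Longrightarrow> emeasure \<nu>' E = emeasure \<nu> (E \<inter> {0..1})"
    unfolding \<nu>'_def using stationary_invariant[OF ifs prob_mu _ _ nu] mu(2,3) cond_A1(1)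
    by (auto simp: A0 A1)
  have fin: "finite_measure \<nu>'"
    using inv by (simp add: invariant_def)
  have ac: "absolutely_continuous lebesgue01 \<nu>" if "d0 = 2 * a0" "d1 = 2 * b1 + c1"
  proof -
    have "measure \<nu>' UNIV = 1"
      using em[of UNIV] prob_space.emeasure_space_1[OF prob_nu] by (simp add: space measure_def)
    then have "absolutely_continuous lborel \<nu>'"
      using invariant_moebius_density[OF inv] that by simp
    then show ?thesis
      unfolding absolutely_continuous_def
      by (auto simp: null_sets_restrict_space) (auto simp: null_sets_def em sets sets_restrict_space Int_absorb2)
  qed
  have sing: "mutually_singular lebesgue01 \<nu>" if C: "\<not> (d0 = 2 * a0 \<and> d1 = 2 * b1 + c1)"
  proof -
    obtain N where N: "N \<in> null_sets lborel" "measure \<nu>' (- N) = 0"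
      using invariant_singular[OF inv C] .
    have "N \<inter> {0..1} \<in> null_sets lborel"
      using N(1) by (intro null_set_Int2) auto
    then have 1: "N \<inter> {0..1} \<in> null_sets lebesgue01"
      by (subst null_sets_restrict_space) auto
    have "emeasure \<nu>' (- N) = 0"
      using N(2) by (simp add: finite_measure.emeasure_eq_measure[OF fin])
    then have "emeasure \<nu> (- N \<inter> {0..1}) = 0"
      using em[of "- N"] N(1) by auto
    moreover have "- N \<inter> {0..1} = space \<nu> - N \<inter> {0..1}"
      by (auto simp: space)
    ultimately show ?thesis
      using 1 unfolding mutually_singular_def by (intro bexI[of _ "N \<inter> {0..1}"]) auto
  qed
  \<comment> \<open>The conditions give absolute continuity and their failure gives singularity; as
    the two properties exclude each other, both converses follow.\<close>
  show ?thesis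
    unfolding i ii using ac sing not_absolutely_continuous_and_mutually_singular[OF prob_nu sets] by blast
qed

end
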